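(* Let $\{L^{\mathcal A}_n\}$ and $\{L^{\mathcal B}_n\}$ be matrix slip-norms on unital C*-algebras $\mathcal A$ and $\mathcal B$, and let $\Pi=(\mathcal D,\omega,E^{\mathcal A},E^{\mathcal B})$ be a bridge with conditional expectations from $\mathcal A$ to $\mathcal B$ that is admissible for $\{L^{\mathcal A}_n\}$ and $\{L^{\mathcal B}_n\}$. For a fixed positive integer $q$ let $\Pi^q$ be the corresponding bridge with conditional expectations from $M_q(\mathcal A)$ to $M_q(\mathcal B)$, with reach, height and length taken with respect to $L^{\mathcal A}_q$ and $L^{\mathcal B}_q$. Define $$\gamma^{\mathcal A}=\sup\{\|a\omega-\omega\Phi^{\mathcal B}(a)\|_{\mathcal D}:a\in\mathcal L^1_{\mathcal A}\},\quad \gamma^{\mathcal B}=\sup\{\|\Phi^{\mathcal A}(b)\omega-\omega b\|_{\mathcal D}:b\in\mathcal L^1_{\mathcal B}\},$$ $$\delta^{\mathcal A}=\sup\{\|\Phi^{\mathcal A}(a)-a\|:a\in\mathcal L^1_{\mathcal A}\},\quad \hat\delta^{\mathcal A}=\sup\{\|a-\Phi^{\mathcal A}(\Phi^{\mathcal B}(a))\|:a\in\mathcal L^1_{\mathcal A}\},$$ $$\delta^{\mathcal B}=\sup\{\|\Phi^{\mathcal B}(b)-b\|:b\in\mathcal L^1_{\mathcal B}\},\quad \hat\delta^{\mathcal B}=\sup\{\|b-\Phi^{\mathcal B}(\Phi^{\mathcal A}(b))\|:b\in\mathcal L^1_{\mathcal B}\}.$$ Then $$\operatorname{reach}(\Pi^q)\le2q\max\{\gamma^{\mathcal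 A},\gamma^{\mathcal B}\},\qquad \operatorname{height}(\Pi^q)\le2q\max\{\min\{\delta^{\mathcal A},\hat\delta^{\mathcal A}\},\min\{\delta^{\mathcal B},\hat\delta^{\mathcal B}\}\},$$ and consequently $$\operatorname{length}(\Pi^q)\le2q\max\{\gamma^{\mathcal A},\gamma^{\mathcal B},\min\{\delta^{\mathcal A},\hat\delta^{\mathcal A}\},\min\{\delta^{\mathcal B},\hat\delta^{\mathcal B}\}\}.$$
   Context: Bridges. For unital C*-algebras $\mathcal A,\mathcal B$, a bridge from $\mathcal A$ to $\mathcal B$ is $\Pi=(\mathcal D,\omega)$, where $\mathcal D$ is a unital C*-algebra into which $\mathcal A$ and $\mathcal B$ are embedded by specified injective unital $*$-homomorphisms (so they are viewed as unital subalgebras of $\mathcal D$), and $\omega=\omega^*\in\mathcal D$ (the pivot) satisfies $\|\omega\|=1$ and $1\in\operatorname{spec}(\omega)$. A slip-norm on $\mathcal A$ is a seminorm $L:\mathcal A\to[0,\infty]$ with $L(a^* )=L(a)$ and $L(1)=0$. Given slip-norms $L^{\mathcal A},L^{\mathcal B}$, put $\mathcal L^1_{\mathcal A}=\{a\in\mathcal A: a=a^*,\ L^{\mathcal A}(a)\le1\}$, similarly $\mathcal L^1_{\mathcal B}$, and $\operatorname{reach}(\Pi)=\operatorname{Haus}_{\mathcal D}(\mathcal L^1_{\mathcal A}\omega,\ \omega\mathcal L^1_{\mathcal B})$ (Hausdorff distance for the norm of $\mathcal D$). Let $S(\cdot)$ denote the state space, $S_1(\omega)=\{\phi\in S(\mathcal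 D):\phi(\omega)=1\}$, and let $S_1^{\mathcal A}(\omega)$, $S_1^{\mathcal B}(\omega)$ be the sets of restrictions of elements of $S_1(\omega)$ to $\mathcal A$, $\mathcal B$. Put $\rho_{\mathcal A}(\mu,\nu)=\sup\{|\mu(a)-\nu(a)|:L^{\mathcal A}(a)\le1\}$ on $S(\mathcal A)$, similarly $\rho_{\mathcal B}$; $\operatorname{height}(\Pi)=\max\{\operatorname{Haus}_{\rho_{\mathcal A}}(S_1^{\mathcal A}(\omega),S(\mathcal A)),\operatorname{Haus}_{\rho_{\mathcal B}}(S_1^{\mathcal B}(\omega),S(\mathcal B))\}$; $\operatorname{length}(\Pi)=\max\{\operatorname{reach}(\Pi),\operatorname{height}(\Pi)\}$. The value $+\infty$ is allowed. Bridges with conditional expectations. A bridge with conditional expectations is $\Pi=(\mathcal D,\omega,E^{\mathcal A},E^{\mathcal B})$, where $(\mathcal D,\omega)$ is a bridge, $\omega$ is a projection, and $E^{\mathcal A},E^{\mathcal B}$ are faithful conditional expectations of $\mathcal D$ onto $\mathcal A,\mathcal B$ with $E^{\mathcal A}(\omega)=r_\omega1_{\mathcal D}=E^{\mathcal B}(\omega)$ for a constant $r_\omega$. Put $\Phi^{\mathcal A}(d)=r_\omega^{-1}E^{\mathcal A}(\omega d\omega)$, $\Phi^{\mathcal B}(d)=r_\omega^{-1}E^{\mathcal B}(\omega d\omega)$ for $d\in\mathcal D$. Its reach, height and length are those of $(\mathcal D,\omega)$. For $q\ge1$, $\Pi^q=(M_q(\mathcal D),\omega_q,E^{\mathcal A}_q,E^{\mathcal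 B}_q)$, where $\omega_q=1_q\otimes\omega$ is the diagonal matrix with $\omega$ in each diagonal entry and $E_q^{\mathcal A},E_q^{\mathcal B}$ are $E^{\mathcal A},E^{\mathcal B}$ applied entrywise; $\Phi_q^{\mathcal A},\Phi_q^{\mathcal B}$ denote $\Phi^{\mathcal A},\Phi^{\mathcal B}$ applied entrywise. Matrix slip-norms. Let $M_{mn}$ be the complex $m\times n$ matrices with the operator norm from $\mathbb C^n$ to $\mathbb C^m$. A matrix slip-norm for $\mathcal A$ is a sequence $\{L_n^{\mathcal A}\}_{n\ge1}$ of seminorms $L^{\mathcal A}_n:M_n(\mathcal A)\to[0,\infty]$ with $L_n^{\mathcal A}(A^* )=L_n^{\mathcal A}(A)$ such that: (1) $L_m^{\mathcal A}(\alpha A\beta)\le\|\alpha\|L_n^{\mathcal A}(A)\|\beta\|$ for $A\in M_n(\mathcal A)$, $\alpha\in M_{mn}$, $\beta\in M_{nm}$; (2) $L_{m+n}^{\mathcal A}\begin{pmatrix}A&0\\0&C\end{pmatrix}=\max(L_m^{\mathcal A}(A),L_n^{\mathcal A}(C))$ for $A\in M_m(\mathcal A)$, $C\in M_n(\mathcal A)$; (3) $L_1^{\mathcal A}$ is a slip-norm. $\Pi$ is admissible for $\{L_n^{\mathcal A}\}$ and $\{L_n^{\mathcal B}\}$ if for all $n\ge1$, $L_n^{\mathcal A}(\Phi_n^{\mathcal A}(B))\le L_n^{\mathcal B}(B)$ for all $B\in M_n(\mathcal B)$ and $L_n^{\mathcal B}(\Phi_n^{\mathcal B}(A))\le L_n^{\mathcal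 A}(A)$ for all $A\in M_n(\mathcal A)$. In the claim, $\mathcal L^1_{\mathcal A}$ and $\mathcal L^1_{\mathcal B}$ are formed with $L_1^{\mathcal A}$ and $L_1^{\mathcal B}$. *)

theory Defs
  imports
    Complex_Main
    "HOL-Library.FuncSet"
    "HOL-Library.Extended_Nonnegative_Real"
    "Jordan_Normal_Form.Matrix"
begin

section \<open>Unital C*-algebras\<close>

text \<open>The operations shared by C*-algebras (as types) and by matrices over them. The norm is not
  included, because the library ties the constant \<open>norm\<close> to normed vector spaces, which matrices of
  varying size do not form.\<close>

class star_ops = plus + minus + times +
  fixes scaleC :: "complex \<Rightarrow> 'a \<Rightarrow> 'a" (infixr \<open>*\<^sub>C\<close> 75)
    and adj :: "'a \<Rightarrow> 'a"

text \<open>The zero algebra is excluded (\<open>norm 1 = 1\<close>). This loses nothing here: the pivot of a bridge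
  has norm 1, so all three algebras of a bridge are nonzero.\<close>

class unital_cstar_algebra = real_normed_algebra_1 + complete_space + star_ops +
  assumes scaleC_add_right: "c *\<^sub>C (x + y) = c *\<^sub>C x + c *\<^sub>C y"
    and scaleC_add_left: "(c + d) *\<^sub>C x = c *\<^sub>C x + d *\<^sub>C x"
    and scaleC_scaleC: "c *\<^sub>C d *\<^sub>C x = (c * d) *\<^sub>C x"
    and scaleC_of_real: "complex_of_real s *\<^sub>C x = s *\<^sub>R x"
    and mult_scaleC_left: "(c *\<^sub>C x) * y = c *\<^sub>C (x * y)"
    and mult_scaleC_right: "x * (c *\<^sub>C y) = c *\<^sub>C (x * y)"
    and norm_scaleC: "norm (c *\<^sub>C x) = cmod c * norm x"
    and adj_adj: "adj (adj x) = x"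
    and adj_add: "adj (x + y) = adj x + adj y"
    and adj_scaleC: "adj (c *\<^sub>C x) = cnj c *\<^sub>C adj x"
    and adj_mult: "adj (x * y) = adj y * adj x"
    and cstar_identity: "norm (adj x * x) = norm x ^ 2"

instantiation complex :: unital_cstar_algebra
begin

definition scaleC_complex :: "complex \<Rightarrow> complex \<Rightarrow> complex" where
  "scaleC_complex c x = c * x"

definition adj_complex :: "complex \<Rightarrow> complex" where
  "adj_complex x = cnj x"

instance
  by standard
    (auto simp: scaleC_complex_def adj_complex_def algebra_simps scaleR_conv_of_real
      norm_mult power2_eq_square)

end

definition spectrum :: "'a::unital_cstar_algebra \<Rightarrow> complex set" where
  "spectrum x = {c. \<not> (\<exists>y. y * (x - c *\<^sub>C 1) = 1 \<and> (x - c *\<^sub>C 1) * y = 1)}"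

definition linear_C :: "('a::star_ops \<Rightarrow> 'b::star_ops) \<Rightarrow> bool" where
  "linear_C f \<longleftrightarrow> (\<forall>x y. f (x + y) = f x + f y) \<and> (\<forall>c x. f (c *\<^sub>C x) = c *\<^sub>C f x)"

definition unital_star_hom ::
  "('a::unital_cstar_algebra \<Rightarrow> 'b::unital_cstar_algebra) \<Rightarrow> bool" where
  "unital_star_hom f \<longleftrightarrow> linear_C f \<and> (\<forall>x y. f (x * y) = f x * f y)
     \<and> (\<forall>x. f (adj x) = adj (f x)) \<and> f 1 = 1"

text \<open>A conditional expectation onto the subalgebra embedded by \<open>\<iota>\<close>, with values pulled back along
  \<open>\<iota>\<close>: a positive linear bimodule projection.\<close>

definition conditional_expectation ::
  "('a::unital_cstar_algebra \<Rightarrow> 'd::unital_cstar_algebra) \<Rightarrow> ('d \<Rightarrow> 'a) \<Rightarrow> bool" where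
  "conditional_expectation \<iota> E \<longleftrightarrow> linear_C E
     \<and> (\<forall>d. \<exists>c. E (adj d * d) = adj c * c)
     \<and> (\<forall>a. E (\<iota> a) = a)
     \<and> (\<forall>a d a'. E (\<iota> a * d * \<iota> a') = a * E d * a')"

definition faithful :: "('d::unital_cstar_algebra \<Rightarrow> 'a::unital_cstar_algebra) \<Rightarrow> bool" where
  "faithful E \<longleftrightarrow> (\<forall>d. E (adj d * d) = 0 \<longrightarrow> d = 0)"


section \<open>Matrix algebras\<close>

text \<open>The norm of a column in the Hilbert C*-module of columns over the algebra.\<close>

definition col_norm :: "'a::unital_cstar_algebra vec \<Rightarrow> real" where
  "col_norm v = sqrt (norm (\<Sum>i<dim_vec v. adj (v $ i) * v $ i))"

instantiation mat :: (unital_cstar_algebra) star_ops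
begin

definition scaleC_mat :: "complex \<Rightarrow> 'a mat \<Rightarrow> 'a mat" where
  "scaleC_mat c X = map_mat (\<lambda>x. c *\<^sub>C x) X"

definition adj_mat :: "'a mat \<Rightarrow> 'a mat" where
  "adj_mat X = mat (dim_col X) (dim_row X) (\<lambda>(i, j). adj (X $$ (j, i)))"

instance ..

end

text \<open>The operator norm of a matrix as a map between column modules. On square matrices of a fixed
  size this is the unique C*-norm; for complex entries it is the operator norm with respect to
  the Euclidean norms.\<close>

definition mat_norm :: "'a::unital_cstar_algebra mat \<Rightarrow> real" where
  "mat_norm X = Sup {col_norm (X *\<^sub>v v) | v. v \<in> carrier_vec (dim_col X) \<and> col_norm v \<le> 1}"

definition of_scalar_mat :: "complex mat \<Rightarrow> 'a::unital_cstar_algebra mat" where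
  "of_scalar_mat \<alpha> = map_mat (\<lambda>z. z *\<^sub>C 1) \<alpha>"

text \<open>Carrier, unit and norm of an algebra; the other operations come from \<open>star_ops\<close>.\<close>

record 'x ualg =
  elems :: "'x set"
  ident :: 'x
  alg_norm :: "'x \<Rightarrow> real"

definition type_alg :: "'a::unital_cstar_algebra ualg" where
  "type_alg = \<lparr>elems = UNIV, ident = 1, alg_norm = norm\<rparr>"

definition mat_alg :: "nat \<Rightarrow> 'a::unital_cstar_algebra mat ualg" where
  "mat_alg n = \<lparr>elems = carrier_mat n n, ident = 1\<^sub>m n, alg_norm = mat_norm\<rparr>"


section \<open>Slip-norms\<close>

definition seminorm_on :: "'x::star_ops set \<Rightarrow> ('x \<Rightarrow> ennreal) \<Rightarrow> bool" where
  "seminorm_on C L \<longleftrightarrow> (\<forall>x\<in>C. \<forall>y\<in>C. L (x + y) \<le> L x + L y)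
     \<and> (\<forall>c. \<forall>x\<in>C. L (c *\<^sub>C x) = ennreal (cmod c) * L x)"

definition slip_norm :: "'x::star_ops ualg \<Rightarrow> ('x \<Rightarrow> ennreal) \<Rightarrow> bool" where
  "slip_norm A L \<longleftrightarrow> seminorm_on (elems A) L \<and> (\<forall>x\<in>elems A. L (adj x) = L x) \<and> L (ident A) = 0"

text \<open>The first level of a matrix slip-norm, under the identification of an algebra with its
  1 by 1 matrices.\<close>

definition level_one :: "(nat \<Rightarrow> 'a mat \<Rightarrow> ennreal) \<Rightarrow> 'a \<Rightarrow> ennreal" where
  "level_one L a = L 1 (mat 1 1 (\<lambda>_. a))"

definition matrix_slip_norm :: "(nat \<Rightarrow> 'a::unital_cstar_algebra mat \<Rightarrow> ennreal) \<Rightarrow> bool" where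
  "matrix_slip_norm L \<longleftrightarrow>
     (\<forall>n\<ge>1. seminorm_on (carrier_mat n n) (L n) \<and> (\<forall>X\<in>carrier_mat n n. L n (adj X) = L n X))
     \<and> (\<forall>m\<ge>1. \<forall>n\<ge>1. \<forall>X\<in>carrier_mat n n. \<forall>\<alpha>\<in>carrier_mat m n. \<forall>\<beta>\<in>carrier_mat n m.
          L m (of_scalar_mat \<alpha> * X * of_scalar_mat \<beta>)
            \<le> ennreal (mat_norm \<alpha>) * L n X * ennreal (mat_norm \<beta>))
     \<and> (\<forall>m\<ge>1. \<forall>n\<ge>1. \<forall>X\<in>carrier_mat m m. \<forall>Y\<in>carrier_mat n n.
          L (m + n) (four_block_mat X (0\<^sub>m m n) (0\<^sub>m n m) Y) = max (L m X) (L n Y))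
     \<and> slip_norm type_alg (level_one L)"

definition slip_ball :: "'x::star_ops ualg \<Rightarrow> ('x \<Rightarrow> ennreal) \<Rightarrow> 'x set" where
  "slip_ball A L = {a \<in> elems A. adj a = a \<and> L a \<le> 1}"


section \<open>States and Hausdorff distance\<close>

definition states :: "'x::star_ops ualg \<Rightarrow> ('x \<Rightarrow> complex) set" where
  "states A = {\<phi> \<in> extensional (elems A).
     (\<forall>x\<in>elems A. \<forall>y\<in>elems A. \<phi> (x + y) = \<phi> x + \<phi> y)
     \<and> (\<forall>c. \<forall>x\<in>elems A. \<phi> (c *\<^sub>C x) = c * \<phi> x)
     \<and> (\<forall>x\<in>elems A. Im (\<phi> (adj x * x)) = 0 \<and> Re (\<phi> (adj x * x)) \<ge> 0)
     \<and> \<phi> (ident A) = 1}"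

definition Haus :: "('x \<Rightarrow> 'x \<Rightarrow> ennreal) \<Rightarrow> 'x set \<Rightarrow> 'x set \<Rightarrow> ennreal" where
  "Haus d X Y = max (SUP x\<in>X. INF y\<in>Y. d x y) (SUP y\<in>Y. INF x\<in>X. d x y)"

definition norm_dist :: "'x::star_ops ualg \<Rightarrow> 'x \<Rightarrow> 'x \<Rightarrow> ennreal" where
  "norm_dist A x y = ennreal (alg_norm A (x - y))"

definition state_dist ::
  "'x::star_ops ualg \<Rightarrow> ('x \<Rightarrow> ennreal) \<Rightarrow> ('x \<Rightarrow> complex) \<Rightarrow> ('x \<Rightarrow> complex) \<Rightarrow> ennreal" where
  "state_dist A L \<mu> \<nu> = (SUP a\<in>{a \<in> elems A. L a \<le> 1}. ennreal (cmod (\<mu> a - \<nu> a)))"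


section \<open>Bridges\<close>

record ('a, 'b, 'd) bridge =
  algA :: "'a ualg"
  algB :: "'b ualg"
  algD :: "'d ualg"
  embA :: "'a \<Rightarrow> 'd"
  embB :: "'b \<Rightarrow> 'd"
  pivot :: 'd

text \<open>Field \<open>pconst\<close> is the constant \<open>r\<^sub>\<omega>\<close>, which the other data of a bridge with conditional
  expectations determine.\<close>

record ('a, 'b, 'd) ce_bridge = "('a, 'b, 'd) bridge" +
  expA :: "'d \<Rightarrow> 'a"
  expB :: "'d \<Rightarrow> 'b"
  pconst :: complex

definition is_bridge :: "('a::unital_cstar_algebra, 'b::unital_cstar_algebra,
    'd::unital_cstar_algebra, 'm) bridge_scheme \<Rightarrow> bool" where
  "is_bridge P \<longleftrightarrow> algA P = type_alg \<and> algB P = type_alg \<and> algD P = type_alg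
     \<and> unital_star_hom (embA P) \<and> inj (embA P)
     \<and> unital_star_hom (embB P) \<and> inj (embB P)
     \<and> adj (pivot P) = pivot P \<and> norm (pivot P) = 1 \<and> 1 \<in> spectrum (pivot P)"

definition is_ce_bridge :: "('a::unital_cstar_algebra, 'b::unital_cstar_algebra,
    'd::unital_cstar_algebra) ce_bridge \<Rightarrow> bool" where
  "is_ce_bridge P \<longleftrightarrow> is_bridge P \<and> pivot P * pivot P = pivot P
     \<and> conditional_expectation (embA P) (expA P) \<and> faithful (expA P)
     \<and> conditional_expectation (embB P) (expB P) \<and> faithful (expB P)
     \<and> expA P (pivot P) = pconst P *\<^sub>C 1 \<and> expB P (pivot P) = pconst P *\<^sub>C 1"

definition bridge_reach :: "('a::star_ops \<Rightarrow> ennreal) \<Rightarrow> ('b::star_ops \<Rightarrow> ennreal) \<Rightarrow>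
    ('a, 'b, 'd::star_ops, 'm) bridge_scheme \<Rightarrow> ennreal" where
  "bridge_reach LA LB P = Haus (norm_dist (algD P))
     ((\<lambda>a. embA P a * pivot P) ` slip_ball (algA P) LA)
     ((\<lambda>b. pivot P * embB P b) ` slip_ball (algB P) LB)"

definition pivot_states ::
  "('a, 'b, 'd::star_ops, 'm) bridge_scheme \<Rightarrow> ('d \<Rightarrow> complex) set" where
  "pivot_states P = {\<phi> \<in> states (algD P). \<phi> (pivot P) = 1}"

definition pivot_states_A ::
  "('a, 'b, 'd::star_ops, 'm) bridge_scheme \<Rightarrow> ('a \<Rightarrow> complex) set" where
  "pivot_states_A P = (\<lambda>\<phi>. restrict (\<phi> \<circ> embA P) (elems (algA P))) ` pivot_states P"

definition pivot_states_B ::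
  "('a, 'b, 'd::star_ops, 'm) bridge_scheme \<Rightarrow> ('b \<Rightarrow> complex) set" where
  "pivot_states_B P = (\<lambda>\<phi>. restrict (\<phi> \<circ> embB P) (elems (algB P))) ` pivot_states P"

definition bridge_height :: "('a::star_ops \<Rightarrow> ennreal) \<Rightarrow> ('b::star_ops \<Rightarrow> ennreal) \<Rightarrow>
    ('a, 'b, 'd::star_ops, 'm) bridge_scheme \<Rightarrow> ennreal" where
  "bridge_height LA LB P = max
     (Haus (state_dist (algA P) LA) (pivot_states_A P) (states (algA P)))
     (Haus (state_dist (algB P) LB) (pivot_states_B P) (states (algB P)))"

definition bridge_length :: "('a::star_ops \<Rightarrow> ennreal) \<Rightarrow> ('b::star_ops \<Rightarrow> ennreal) \<Rightarrow>
    ('a, 'b, 'd::star_ops, 'm) bridge_scheme \<Rightarrow> ennreal" where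
  "bridge_length LA LB P = max (bridge_reach LA LB P) (bridge_height LA LB P)"

definition PhiA ::
  "('a::star_ops, 'b, 'd::star_ops) ce_bridge \<Rightarrow> 'd \<Rightarrow> 'a" where
  "PhiA P d = inverse (pconst P) *\<^sub>C expA P (pivot P * d * pivot P)"

definition PhiB ::
  "('a, 'b::star_ops, 'd::star_ops) ce_bridge \<Rightarrow> 'd \<Rightarrow> 'b" where
  "PhiB P d = inverse (pconst P) *\<^sub>C expB P (pivot P * d * pivot P)"

text \<open>The bridge \<open>P\<^sup>q\<close> between the algebras of \<open>q\<close> by \<open>q\<close> matrices.\<close>

definition amplify :: "nat \<Rightarrow> ('a::unital_cstar_algebra, 'b::unital_cstar_algebra,
    'd::unital_cstar_algebra) ce_bridge \<Rightarrow> ('a mat, 'b mat, 'd mat) ce_bridge" where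
  "amplify q P = \<lparr>algA = mat_alg q, algB = mat_alg q, algD = mat_alg q,
     embA = map_mat (embA P), embB = map_mat (embB P),
     pivot = mat q q (\<lambda>(i, j). if i = j then pivot P else 0),
     expA = map_mat (expA P), expB = map_mat (expB P), pconst = pconst P\<rparr>"

definition admissible :: "(nat \<Rightarrow> 'a::unital_cstar_algebra mat \<Rightarrow> ennreal) \<Rightarrow>
    (nat \<Rightarrow> 'b::unital_cstar_algebra mat \<Rightarrow> ennreal) \<Rightarrow>
    ('a, 'b, 'd::unital_cstar_algebra) ce_bridge \<Rightarrow> bool" where
  "admissible LA LB P \<longleftrightarrow> (\<forall>n\<ge>1.
     (\<forall>Y\<in>carrier_mat n n. LA n (map_mat (\<lambda>b. PhiA P (embB P b)) Y) \<le> LB n Y)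
     \<and> (\<forall>X\<in>carrier_mat n n. LB n (map_mat (\<lambda>a. PhiB P (embA P a)) X) \<le> LA n X))"


section \<open>The constants in the bounds\<close>

definition gammaA :: "(nat \<Rightarrow> 'a::unital_cstar_algebra mat \<Rightarrow> ennreal) \<Rightarrow>
    ('a, 'b::unital_cstar_algebra, 'd::unital_cstar_algebra) ce_bridge \<Rightarrow> ennreal" where
  "gammaA LA P = (SUP a\<in>slip_ball type_alg (level_one LA).
     ennreal (norm (embA P a * pivot P - pivot P * embB P (PhiB P (embA P a)))))"

definition gammaB :: "(nat \<Rightarrow> 'b::unital_cstar_algebra mat \<Rightarrow> ennreal) \<Rightarrow>
    ('a::unital_cstar_algebra, 'b, 'd::unital_cstar_algebra) ce_bridge \<Rightarrow> ennreal" where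
  "gammaB LB P = (SUP b\<in>slip_ball type_alg (level_one LB).
     ennreal (norm (embA P (PhiA P (embB P b)) * pivot P - pivot P * embB P b)))"

definition deltaA :: "(nat \<Rightarrow> 'a::unital_cstar_algebra mat \<Rightarrow> ennreal) \<Rightarrow>
    ('a, 'b::unital_cstar_algebra, 'd::unital_cstar_algebra) ce_bridge \<Rightarrow> ennreal" where
  "deltaA LA P = (SUP a\<in>slip_ball type_alg (level_one LA).
     ennreal (norm (PhiA P (embA P a) - a)))"

definition delta_hatA :: "(nat \<Rightarrow> 'a::unital_cstar_algebra mat \<Rightarrow> ennreal) \<Rightarrow>
    ('a, 'b::unital_cstar_algebra, 'd::unital_cstar_algebra) ce_bridge \<Rightarrow> ennreal" where
  "delta_hatA LA P = (SUP a\<in>slip_ball type_alg (level_one LA).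
     ennreal (norm (a - PhiA P (embB P (PhiB P (embA P a))))))"

definition deltaB :: "(nat \<Rightarrow> 'b::unital_cstar_algebra mat \<Rightarrow> ennreal) \<Rightarrow>
    ('a::unital_cstar_algebra, 'b, 'd::unital_cstar_algebra) ce_bridge \<Rightarrow> ennreal" where
  "deltaB LB P = (SUP b\<in>slip_ball type_alg (level_one LB).
     ennreal (norm (PhiB P (embB P b) - b)))"

definition delta_hatB :: "(nat \<Rightarrow> 'b::unital_cstar_algebra mat \<Rightarrow> ennreal) \<Rightarrow>
    ('a::unital_cstar_algebra, 'b, 'd::unital_cstar_algebra) ce_bridge \<Rightarrow> ennreal" where
  "delta_hatB LB P = (SUP b\<in>slip_ball type_alg (level_one LB).
     ennreal (norm (b - PhiB P (embA P (PhiA P (embB P b))))))"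

end

theory Submission
  imports
    Defs
    "HOL-Library.Nonpos_Ints"
    "HOL-Computational_Algebra.Formal_Power_Series"
    "HOL-Analysis.Elementary_Metric_Spaces"
begin

text \<open>For the reach, a self-adjoint matrix \<open>X\<close> over one algebra is matched with its entrywise image
  under \<open>\<Phi>\<close>, which stays in the unit ball of the slip-norm by admissibility. For the height, a
  state \<open>\<mu>\<close> of the matrices over \<open>A\<close> is matched with \<open>\<mu> \<circ> \<Phi>\<^sup>A\<close> or with \<open>\<mu> \<circ> \<Phi>\<^sup>A \<circ> \<Phi>\<^sup>B\<close>, which are
  states because conditional expectations are completely positive. Both errors are governed by
  entries: the entries of \<open>X\<close> have slip-norm at most that of \<open>X\<close>, splitting them into real and
  imaginary parts costs the factor 2, and a \<open>q\<close> by \<open>q\<close> matrix with entries of norm at most \<open>M\<close> has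
  norm at most \<open>q M\<close>, as has its value under a state. The C*-theory behind this (square roots,
  positivity of \<open>x* x\<close>, and Cholesky factorization of positive matrices) is carried out in the
  entry algebra, so that no completeness or spectral theory of matrix algebras is needed.\<close>

section \<open>Positive elements of a C*-algebra\<close>

text \<open>The states \<open>\<mu> \<circ> \<Phi>\<close> take the value 1 at the pivot because
  \<open>\<Phi> d\<close> is \<open>E (\<omega> * d * \<omega>)\<close> divided by \<open>r\<close>,
  and \<open>E \<omega>\<close> is \<open>r\<close> times the unit. The obstacle is that a state is
  known to be nonnegative only at matrices of the form \<open>adj X * X\<close>, while
  \<open>\<Phi>\<close> applied entrywise to such a matrix yields merely one whose quadratic form is
  positive at all columns. Cholesky factorization restores the first form, but it inverts diagonal
  entries; so \<open>e\<close> times the unit matrix is added first, and \<open>e\<close> tends to 0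
  afterwards. Within the entry algebra everything starts from a spectrum-free notion of positivity,
  \<open>norm (t - h) \<le> t\<close>: sums are immediate, and after scaling it is the convergence
  condition of the binomial series of the square root.\<close>

instance unital_cstar_algebra \<subseteq> banach ..

section \<open>Scalars, adjoint and norm\<close>

lemma scaleR_eq_scaleC: "r *\<^sub>R (x::'a::unital_cstar_algebra) = complex_of_real r *\<^sub>C x"
  by (simp add: scaleC_of_real)

lemma scaleC_one [simp]: "1 *\<^sub>C (x::'a::unital_cstar_algebra) = x"
  using scaleC_of_real[of 1 x] by simp

lemma scaleC_zero_left [simp]: "0 *\<^sub>C (x::'a::unital_cstar_algebra) = 0"
  using scaleC_of_real[of 0 x] by simp

lemma scaleC_zero_right [simp]: "c *\<^sub>C (0::'a::unital_cstar_algebra) = 0"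
  by (metis add_cancel_right_right scaleC_add_right)

lemma scaleC_minus_one: "(-1) *\<^sub>C (x::'a::unital_cstar_algebra) = - x"
  using scaleC_of_real[of "-1" x] by simp

lemma scaleC_minus_left: "(- c) *\<^sub>C x = - (c *\<^sub>C (x::'a::unital_cstar_algebra))"
  by (metis mult_minus1 scaleC_minus_one scaleC_scaleC)

lemma scaleC_minus_right: "c *\<^sub>C (- x) = - (c *\<^sub>C (x::'a::unital_cstar_algebra))"
  by (metis add.right_inverse neg_eq_iff_add_eq_0 scaleC_add_right scaleC_zero_right)

lemma scaleC_diff_right: "c *\<^sub>C (x - y) = c *\<^sub>C x - c *\<^sub>C (y::'a::unital_cstar_algebra)"
  using scaleC_add_right[of c x "- y"] by (simp add: scaleC_minus_right)

lemma adj_zero [simp]: "adj (0::'a::unital_cstar_algebra) = 0"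
  by (metis add_cancel_right_right adj_add)

lemma adj_one [simp]: "adj (1::'a::unital_cstar_algebra) = 1"
  by (metis adj_adj adj_mult mult.right_neutral)

lemma adj_scaleR: "adj (r *\<^sub>R x) = r *\<^sub>R adj (x::'a::unital_cstar_algebra)"
  by (simp add: scaleR_eq_scaleC adj_scaleC)

lemma adj_minus: "adj (- x) = - adj (x::'a::unital_cstar_algebra)"
  by (metis add.right_inverse adj_add adj_zero neg_eq_iff_add_eq_0)

lemma adj_diff: "adj (x - y) = adj x - adj (y::'a::unital_cstar_algebra)"
  using adj_add[of x "- y"] by (simp add: adj_minus)

lemma adj_sum: "adj (\<Sum>i\<in>I. f i) = (\<Sum>i\<in>I. adj (f i :: 'a::unital_cstar_algebra))"
  by (induction I rule: infinite_finite_induct) (auto simp: adj_add)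

lemma adj_power: "adj (x ^ n) = adj (x::'a::unital_cstar_algebra) ^ n"
  by (induction n) (auto simp: adj_mult power_commutes)

lemmas adj_simps = adj_add adj_diff adj_minus adj_mult adj_scaleR adj_scaleC adj_sum adj_adj adj_power

lemma norm_adj [simp]: "norm (adj x) = norm (x::'a::unital_cstar_algebra)"
proof -
  have "norm y \<le> norm (adj y)" for y :: 'a
  proof (cases "y = 0")
    case False
    have "norm y * norm y = norm (adj y * y)" by (simp add: cstar_identity power2_eq_square)
    also have "\<dots> \<le> norm (adj y) * norm y" by (rule norm_mult_ineq)
    finally show ?thesis using False by simp
  qed simp
  from this[of x] this[of "adj x"] show ?thesis by (simp add: adj_adj)
qed

lemma bounded_linear_adj: "bounded_linear (adj :: 'a::unital_cstar_algebra \<Rightarrow> 'a)"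
  by (rule bounded_linear_intro[where K = 1]) (auto simp: adj_simps)

lemma norm_square_selfadj: "adj h = h \<Longrightarrow> norm (h * h) = (norm (h::'a::unital_cstar_algebra))\<^sup>2"
  using cstar_identity[of h] by simp

lemma adj_mult_self_eq_0: "adj x * x = 0 \<Longrightarrow> (x::'a::unital_cstar_algebra) = 0"
  using cstar_identity[of x] by simp

text \<open>Apply the C*-identity to \<open>h + \<i> k\<close>, whose real part is \<open>h\<close>.\<close>

lemma norm_square_le_norm_add_squares:
  fixes h k :: "'a::unital_cstar_algebra"
  assumes "adj h = h" "adj k = k" "h * k = k * h"
  shows "(norm h)\<^sup>2 \<le> norm (h * h + k * k)"
proof -
  define u where "u = h + \<i> *\<^sub>C k"
  have "adj u * u = h * h + k * k"
    using assms
    by (simp add: u_def adj_simps algebra_simps mult_scaleC_left mult_scaleC_right scaleC_scaleC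
        scaleC_add_right scaleC_minus_one flip: scaleC_add_left)
  then have u: "(norm u)\<^sup>2 = norm (h * h + k * k)" by (metis cstar_identity)
  have "2 *\<^sub>R h = u + adj u"
    using assms by (simp add: u_def adj_simps scaleR_2 algebra_simps flip: scaleC_add_left)
  then have "2 * norm h \<le> norm u + norm (adj u)"
    by (metis norm_scaleR norm_triangle_ineq abs_numeral real_norm_def)
  then show ?thesis using u power_mono[of "norm h" "norm u" 2] by simp
qed

section \<open>Coefficients of the power series of \<open>sqrt (1 - t)\<close>\<close>

definition half_coeff :: "nat \<Rightarrow> real" where
  "half_coeff n = (-1) ^ n * ((1 / 2) gchoose n)"

text \<open>The first coefficient is \<open>- 1 / 2\<close>, and from there on the ratio of
  consecutive ones is \<open>(n - 1 / 2) / (n + 1) \<ge> 0\<close>.\<close>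

lemma half_coeff_nonpos:
  assumes "n > 0" shows "half_coeff n \<le> 0"
proof -
  obtain m where n: "n = Suc m" using assms by (cases n) auto
  have "half_coeff (Suc m) \<le> 0"
  proof (induction m)
    case 0
    then show ?case by (simp add: half_coeff_def)
  next
    case (Suc m)
    have "((1 / 2 :: real) gchoose Suc (Suc m)) =
        ((1 / 2) gchoose Suc m) * ((1 / 2 - real (Suc m)) / real (Suc (Suc m)))"
      using gbinomial_factors[of "1 / 2 :: real" "Suc m"] gbinomial_mult_1[of "1/2::real" "Suc m"]
      by (simp add: field_simps)
    also have "(1 / 2 - real (Suc m)) / real (Suc (Suc m)) =
        - ((real (Suc m) - 1 / 2) / real (Suc (Suc m)))"
      by (simp add: field_simps)
    finally have "half_coeff (Suc (Suc m)) =
        half_coeff (Suc m) * ((real (Suc m) - 1 / 2) / real (Suc (Suc m)))"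
      unfolding half_coeff_def by simp
    moreover have "(real (Suc m) - 1 / 2) / real (Suc (Suc m)) \<ge> 0" by simp
    ultimately show ?case using Suc.IH mult_nonpos_nonneg by metis
  qed
  then show ?thesis using n by simp
qed

lemma half_coeff_0 [simp]: "half_coeff 0 = 1"
  by (simp add: half_coeff_def)

text \<open>Dividing a power series by \<open>1 - t\<close> turns coefficients into partial sums, so
  this is the coefficient of \<open>t ^ m\<close> in \<open>(1 - t) powr (- 1 / 2)\<close>, all of
  which are nonnegative.\<close>

lemma half_coeff_sum_nonneg: "(\<Sum>n\<le>m. half_coeff n) \<ge> 0"
proof -
  have neg: "(-1) ^ m * (((- 1 / 2) :: real) gchoose m) \<ge> 0"
  proof (induction m)
    case (Suc m)
    have "((- 1 / 2 :: real) gchoose Suc m) =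
        ((- 1 / 2) gchoose m) * ((- 1 / 2 - real m) / real (Suc m))"
      using gbinomial_mult_1[of "-1/2::real" m]
      by (simp add: field_simps)
    also have "(- 1 / 2 - real m) / real (Suc m) = - ((1 / 2 + real m) / real (Suc m))"
      by (simp add: field_simps)
    finally have "(-1) ^ Suc m * ((- 1 / 2 :: real) gchoose Suc m) =
        ((-1) ^ m * ((- 1 / 2) gchoose m)) * ((1 / 2 + real m) / real (Suc m))"
      by simp
    with Suc.IH show ?case by simp
  qed simp
  have "(\<Sum>n\<le>m. half_coeff n) = (\<Sum>n\<le>m. ((1 / 2) gchoose n) * (-1) ^ n)"
    by (simp add: half_coeff_def mult.commute)
  also have "\<dots> = (-1) ^ m * ((1 / 2 - 1) gchoose m)"
    by (rule gbinomial_sum_lower_neg)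
  finally show ?thesis using neg by simp
qed

text \<open>The terms share one sign, so the sum is 1 minus a partial sum of the full
  series.\<close>

lemma half_coeff_abs_sum: "(\<Sum>n<m. \<bar>half_coeff (Suc n)\<bar>) \<le> 1"
proof -
  have "(\<Sum>n<m. \<bar>half_coeff (Suc n)\<bar>) = (\<Sum>n<m. - half_coeff (Suc n))"
    by (intro sum.cong) (auto simp: half_coeff_nonpos)
  also have "\<dots> = 1 - (\<Sum>n<Suc m. half_coeff n)"
    unfolding sum.lessThan_Suc_shift by (simp add: sum_negf)
  also have "\<dots> \<le> 1" using half_coeff_sum_nonneg[of m] by (simp add: lessThan_Suc_atMost)
  finally show ?thesis .
qed

text \<open>Vandermonde's identity. The right-hand side gives the coefficients of
  \<open>1 - t\<close>, the square of the series.\<close>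

lemma half_coeff_convolution:
  "(\<Sum>i\<le>n. half_coeff i * half_coeff (n - i)) = (-1) ^ n * (1 gchoose n)"
proof -
  have "(\<Sum>i\<le>n. half_coeff i * half_coeff (n - i))
      = (\<Sum>i=0..n. (-1) ^ n * (((1 / 2) gchoose i) * ((1 / 2) gchoose (n - i))))"
    by (intro sum.cong) (auto simp: half_coeff_def power_add[symmetric] algebra_simps)
  also have "\<dots> = (-1) ^ n * (\<Sum>i=0..n. ((1 / 2) gchoose i) * ((1 / 2) gchoose (n - i)))"
    by (simp add: sum_distrib_left)
  also have "\<dots> = (-1) ^ n * ((1 / 2 + 1 / 2) gchoose n)"
    by (simp only: gbinomial_Vandermonde)
  finally show ?thesis by simp
qed

text \<open>The binomial series of \<open>(1 - t) powr (1 / 2)\<close> converges absolutely on the closed unit ball: its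
  coefficients other than the first are nonpositive and their absolute values sum to at most 1.\<close>

lemma sqrt_one_minus:
  fixes k :: "'a::unital_cstar_algebra"
  assumes k: "adj k = k" "norm k \<le> 1"
  obtains s where "adj s = s" "s * s = 1 - k" "norm (1 - s) \<le> 1"
    "\<forall>w. w * k = k * w \<longrightarrow> w * s = s * w"
proof -
  define f where "f n = half_coeff n *\<^sub>R k ^ n" for n
  have nf: "norm (f (Suc n)) \<le> \<bar>half_coeff (Suc n)\<bar>" for n
  proof -
    have "norm (k ^ Suc n) \<le> 1"
      using norm_power_ineq[of k "Suc n"] k(2) power_le_one[of "norm k" "Suc n"] by simp
    then show ?thesis unfolding f_def norm_scaleR by (simp add: mult_left_le)
  qed
  have sc: "summable (\<lambda>n. \<bar>half_coeff (Suc n)\<bar>)"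
    by (rule bounded_imp_summable[of _ 1])
      (simp_all add: half_coeff_abs_sum flip: lessThan_Suc_atMost del: sum.lessThan_Suc)
  have sn': "summable (\<lambda>n. norm (f (Suc n)))"
    by (rule summable_comparison_test[OF _ sc]) (use nf in auto)
  then have sn: "summable (\<lambda>n. norm (f n))" by (rule iffD1[OF summable_Suc_iff])
  then have sf: "summable f" by (rule summable_norm_cancel)
  define s where "s = (\<Sum>n. f n)"
  have s_sums: "f sums s" unfolding s_def using sf by (rule summable_sums)
  have "adj s = s"
  proof -
    have "(\<lambda>n. adj (f n)) sums adj s" by (rule bounded_linear.sums[OF bounded_linear_adj s_sums])
    moreover have "(\<lambda>n. adj (f n)) = f" by (auto simp: f_def adj_simps k)
    ultimately show ?thesis using s_sums sums_unique2 by metis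
  qed
  moreover have "s * s = 1 - k"
  proof -
    have "(\<lambda>n. \<Sum>i\<le>n. f i * f (n - i)) sums (s * s)"
      unfolding s_def by (rule Cauchy_product_sums[OF sn sn])
    moreover have "(\<Sum>i\<le>n. f i * f (n - i)) = ((-1) ^ n * (1 gchoose n)) *\<^sub>R k ^ n" for n
    proof -
      have "(\<Sum>i\<le>n. f i * f (n - i)) = (\<Sum>i\<le>n. (half_coeff i * half_coeff (n - i)) *\<^sub>R k ^ n)"
        by (intro sum.cong) (auto simp: f_def power_add[symmetric])
      then show ?thesis by (simp only: half_coeff_convolution flip: scaleR_left.sum)
    qed
    ultimately have 1: "(\<lambda>n. ((-1) ^ n * ((1::real) gchoose n)) *\<^sub>R k ^ n) sums (s * s)" by simp
    have "(1::real) gchoose n = 0" if "n \<notin> {..<2}" for n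
      using that binomial_gbinomial[of 1 n, where ?'a = real] by (simp add: binomial_eq_0)
    then have "(\<lambda>n. ((-1) ^ n * ((1::real) gchoose n)) *\<^sub>R k ^ n) sums
        (\<Sum>n<2. ((-1) ^ n * ((1::real) gchoose n)) *\<^sub>R k ^ n)"
      by (intro sums_finite) auto
    then show ?thesis using 1 sums_unique2 by (fastforce simp: numeral_2_eq_2)
  qed
  \<comment> \<open>This bound later shows that the root is itself positive, with
    \<open>t = 1\<close> in the definition of \<open>pos\<close>.\<close>
  moreover have "norm (1 - s) \<le> 1"
  proof -
    have "(\<lambda>n. f (Suc n)) sums (s - 1)" using s_sums sums_Suc_iff[of f "s - 1"] by (simp add: f_def)
    then have "norm (s - 1) \<le> (\<Sum>n. norm (f (Suc n)))" using summable_norm[OF sn'] sums_unique by metis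
    also have "\<dots> \<le> (\<Sum>n. \<bar>half_coeff (Suc n)\<bar>)" by (rule suminf_le[OF nf sn' sc])
    also have "\<dots> \<le> 1" by (rule suminf_le_const[OF sc half_coeff_abs_sum])
    finally show ?thesis by (simp add: norm_minus_commute)
  qed
  moreover have "\<forall>w. w * k = k * w \<longrightarrow> w * s = s * w"
  proof (intro allI impI)
    fix w assume that: "w * k = k * w"
    have "w * k ^ n = k ^ n * w" for n
      by (induction n) (auto simp: that mult.assoc, metis that mult.assoc)
    then have "w * f n = f n * w" for n by (simp add: f_def)
    then show "w * s = s * w" unfolding s_def
      by (simp add: suminf_mult[OF sf, symmetric] suminf_mult2[OF sf])
  qed
  ultimately show ?thesis by (rule that)
qed

text \<open>For self-adjoint \<open>h\<close> the inequality says that the spectrum lies in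
  \<open>[0, 2 t]\<close>.\<close>

definition pos :: "'a::unital_cstar_algebra \<Rightarrow> bool" where
  "pos h \<longleftrightarrow> adj h = h \<and> (\<exists>t\<ge>0. norm (t *\<^sub>R 1 - h) \<le> t)"

lemma pos_selfadj: "pos h \<Longrightarrow> adj h = h"
  by (simp add: pos_def)

lemma posI: "adj h = h \<Longrightarrow> norm (t *\<^sub>R 1 - h) \<le> t \<Longrightarrow> pos h"
  unfolding pos_def by (meson norm_ge_zero order_trans)

lemma pos_scaleR_one: "r \<ge> 0 \<Longrightarrow> pos (r *\<^sub>R (1::'a::unital_cstar_algebra))"
  by (rule posI[of _ r]) (auto simp: adj_simps)

lemma pos_zero [simp]: "pos (0::'a::unital_cstar_algebra)"
  by (rule posI[of _ 0]) auto

lemma pos_add: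
  assumes "pos h" "pos k" shows "pos (h + k)"
proof -
  obtain s t where "norm (s *\<^sub>R 1 - h) \<le> s" "norm (t *\<^sub>R 1 - k) \<le> t"
    using assms unfolding pos_def by blast
  then have "norm ((s *\<^sub>R 1 - h) + (t *\<^sub>R 1 - k)) \<le> s + t" by (metis add_mono norm_triangle_ineq order_trans)
  then show ?thesis
    using assms by (intro posI[of _ "s + t"]) (auto simp: adj_simps pos_selfadj algebra_simps)
qed

lemma pos_sum: "(\<And>i. i \<in> I \<Longrightarrow> pos (f i)) \<Longrightarrow> pos (\<Sum>i\<in>I. f i)"
  by (induction I rule: infinite_finite_induct) (auto intro: pos_add)

lemma pos_scaleR:
  assumes "pos h" "r \<ge> 0" shows "pos (r *\<^sub>R h)"
proof -
  obtain t where "norm (t *\<^sub>R 1 - h) \<le> t" using assms unfolding pos_def by blast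
  then have "norm (r *\<^sub>R (t *\<^sub>R 1 - h)) \<le> r * t" using assms(2) by (simp add: mult_left_mono)
  then show ?thesis
    using assms by (intro posI[of _ "r * t"]) (auto simp: adj_simps pos_selfadj scaleR_diff_right)
qed

lemma pos_norm_minus: "adj h = h \<Longrightarrow> pos (norm h *\<^sub>R 1 - h)"
  by (rule posI[of _ "norm h"]) (auto simp: adj_simps)

text \<open>Scaling turns the inequality in \<open>pos\<close> into
  \<open>norm (1 - h / t) \<le> 1\<close>, so \<open>sqrt_one_minus\<close> applies. The commutation
  clause stands for the fact that the root is a limit of polynomials in \<open>h\<close>.\<close>

lemma pos_sqrt:
  fixes h :: "'a::unital_cstar_algebra"
  assumes "pos h"
  obtains s where "pos s" "s * s = h" "\<forall>w. w * h = h * w \<longrightarrow> w * s = s * w"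
proof -
  obtain t where t: "t \<ge> 0" "norm (t *\<^sub>R 1 - h) \<le> t" using assms unfolding pos_def by blast
  show ?thesis
  proof (cases "t = 0")
    case True
    then show ?thesis using t that[of 0] by simp
  next
    case False
    define k where "k = 1 - (1 / t) *\<^sub>R h"
    have "norm ((1 / t) *\<^sub>R (t *\<^sub>R 1 - h)) \<le> 1" using t False by (simp add: divide_simps)
    then have "norm k \<le> 1" using False by (simp add: k_def scaleR_diff_right)
    moreover have "adj k = k" using assms by (simp add: k_def adj_simps pos_selfadj)
    ultimately have "adj k = k" "norm k \<le> 1" by blast+
    then obtain s where s: "adj s = s" "s * s = 1 - k" "norm (1 - s) \<le> 1"
      "\<forall>w. w * k = k * w \<longrightarrow> w * s = s * w" by (rule sqrt_one_minus)
    show ?thesis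
    proof (rule that[of "sqrt t *\<^sub>R s"])
      show "pos (sqrt t *\<^sub>R s)"
        using s(1,3) t(1) by (intro pos_scaleR posI[of s 1]) auto
      show "sqrt t *\<^sub>R s * sqrt t *\<^sub>R s = h" using s(2) t False by (simp add: k_def)
      have "w * sqrt t *\<^sub>R s = sqrt t *\<^sub>R s * w" if "w * h = h * w" for w
      proof -
        have "w * k = k * w" by (simp add: k_def algebra_simps that)
        then show ?thesis using s(4) by simp
      qed
      then show "\<forall>w. w * h = h * w \<longrightarrow> w * sqrt t *\<^sub>R s = sqrt t *\<^sub>R s * w" by blast
    qed
  qed
qed

text \<open>Scale to norm 1. The root \<open>s\<close> of \<open>1 - g * g\<close> commutes with
  \<open>g\<close>, and \<open>s * s + g * g = 1\<close> forces \<open>norm s \<le> 1\<close>, hence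
  \<open>norm (1 - g * g) \<le> 1\<close>.\<close>

lemma pos_square:
  fixes h :: "'a::unital_cstar_algebra"
  assumes "adj h = h" shows "pos (h * h)"
proof (cases "h = 0")
  case False
  define g where "g = (1 / norm h) *\<^sub>R h"
  have g: "adj g = g" "norm g = 1" using assms False by (auto simp: g_def adj_simps)
  then have "adj (g * g) = g * g" "norm (g * g) \<le> 1"
    by (simp_all add: norm_square_selfadj adj_simps)
  then obtain s where s: "adj s = s" "s * s = 1 - g * g" "norm (1 - s) \<le> 1"
    "\<forall>w. w * (g * g) = g * g * w \<longrightarrow> w * s = s * w"
    by (rule sqrt_one_minus)
  have "(norm s)\<^sup>2 \<le> norm (s * s + g * g)"
    by (intro norm_square_le_norm_add_squares s(1) g(1) s(4)[rule_format, symmetric])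
      (simp add: mult.assoc)
  then have "norm (1 - g * g) \<le> 1" using s(1,2) norm_square_selfadj[of s] by simp
  then have "pos (g * g)" using g by (intro posI[of _ 1]) (auto simp: adj_simps)
  then have "pos ((norm h)\<^sup>2 *\<^sub>R (g * g))" by (intro pos_scaleR) auto
  then show ?thesis using False by (simp add: g_def power2_eq_square)
qed simp

text \<open>The roots \<open>s\<close> of \<open>h\<close> and \<open>r\<close> of
  \<open>t - h\<close> commute and their squares add up to \<open>t\<close>, so
  \<open>norm h\<close>, which is the square of \<open>norm s\<close>, is at most
  \<open>t\<close>.\<close>

lemma pos_norm_le:
  fixes h :: "'a::unital_cstar_algebra"
  assumes "pos h" "pos (t *\<^sub>R 1 - h)" "t \<ge> 0"
  shows "norm h \<le> t"
proof -
  obtain s where s: "pos s" "s * s = h" "\<forall>w. w * h = h * w \<longrightarrow> w * s = s * w"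
    by (rule pos_sqrt[OF assms(1)])
  obtain r where r: "pos r" "r * r = t *\<^sub>R 1 - h"
    "\<forall>w. w * (t *\<^sub>R 1 - h) = (t *\<^sub>R 1 - h) * w \<longrightarrow> w * r = r * w"
    by (rule pos_sqrt[OF assms(2)])
  have "s * h = h * s" by (simp add: mult.assoc flip: s(2))
  then have "s * r = r * s" by (intro r(3)[rule_format]) (simp add: algebra_simps)
  then have "(norm s)\<^sup>2 \<le> norm (s * s + r * r)"
    by (intro norm_square_le_norm_add_squares pos_selfadj s(1) r(1))
  then show ?thesis using s(1,2) r(2) norm_square_selfadj[of s] assms(3) by (simp add: pos_selfadj)
qed

lemma pos_norm_mono:
  fixes h k :: "'a::unital_cstar_algebra"
  assumes "pos h" "pos (k - h)"
  shows "norm h \<le> norm k"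
proof (rule pos_norm_le[OF assms(1)])
  have "pos k" using pos_add[OF assms] by simp
  then have "pos ((norm k *\<^sub>R 1 - k) + (k - h))"
    by (intro pos_add pos_norm_minus assms(2)) (simp add: pos_selfadj)
  then show "pos (norm k *\<^sub>R 1 - h)" by simp
qed simp

lemma pos_antisym: "pos h \<Longrightarrow> pos (- h) \<Longrightarrow> h = 0"
  using pos_norm_mono[of h 0] by simp

text \<open>The functional calculus identity \<open>p(z z*) = p(0) + z q(z* z) z*\<close>, for \<open>p(y) = (t + y)^n\<close>.\<close>

lemma power_shift_expansion:
  fixes z w :: "'a::real_normed_algebra_1"
  assumes "norm (t *\<^sub>R 1 + w * z) \<le> t" "t \<ge> 0"
  shows "\<exists>f. (t *\<^sub>R 1 + z * w) ^ n = t ^ n *\<^sub>R 1 + z * f * w \<and> t * norm f \<le> n * t ^ n"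
proof (induction n)
  case 0
  show ?case by (rule exI[of _ 0]) simp
next
  case (Suc n)
  then obtain f where f: "(t *\<^sub>R 1 + z * w) ^ n = t ^ n *\<^sub>R 1 + z * f * w" "t * norm f \<le> n * t ^ n"
    by blast
  \<comment> \<open>The witness comes from \<open>(t + z * w) * z = z * (t + w * z)\<close>:
    multiplying the expansion by \<open>t + z * w\<close> moves that factor inside, where its norm
    is at most \<open>t\<close>.\<close>
  show ?case
  proof (intro exI[of _ "t ^ n *\<^sub>R 1 + (t *\<^sub>R 1 + w * z) * f"] conjI)
    show "(t *\<^sub>R 1 + z * w) ^ Suc n =
        t ^ Suc n *\<^sub>R 1 + z * (t ^ n *\<^sub>R 1 + (t *\<^sub>R 1 + w * z) * f) * w"
      unfolding power_Suc f(1) by (simp add: algebra_simps)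
    have "norm (t ^ n *\<^sub>R 1 + (t *\<^sub>R 1 + w * z) * f)
        \<le> norm (t ^ n *\<^sub>R (1::'a)) + norm ((t *\<^sub>R 1 + w * z) * f)" by (rule norm_triangle_ineq)
    also have "\<dots> \<le> t ^ n + t * norm f"
      using assms mult_right_mono[OF assms(1), of "norm f"]
        norm_mult_ineq[of "t *\<^sub>R 1 + w * z" f] by simp
    finally have "t * norm (t ^ n *\<^sub>R 1 + (t *\<^sub>R 1 + w * z) * f) \<le> t * (t ^ n + t * norm f)"
      using assms(2) by (rule mult_left_mono)
    also have "\<dots> \<le> t * (t ^ n + n * t ^ n)" using f(2) assms(2) by (intro mult_left_mono) auto
    finally show "t * norm (t ^ n *\<^sub>R 1 + (t *\<^sub>R 1 + w * z) * f) \<le> real (Suc n) * t ^ Suc n"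
      by (simp add: algebra_simps)
  qed
qed

lemma norm_power_selfadj:
  fixes h :: "'a::unital_cstar_algebra"
  assumes "adj h = h"
  shows "norm (h ^ (2 ^ k)) = norm h ^ (2 ^ k)"
proof (induction k)
  case (Suc k)
  have "norm (h ^ (2 ^ Suc k)) = norm (h ^ (2 ^ k) * h ^ (2 ^ k))"
    by (simp only: power_Suc mult_2 power_add)
  also have "\<dots> = (norm (h ^ (2 ^ k)))\<^sup>2" by (rule norm_square_selfadj) (simp add: adj_simps assms)
  finally show ?case using Suc by (simp add: power_mult[symmetric] mult.commute)
qed simp

text \<open>Bernoulli's inequality is only linear in the exponent, like the bound to be
  contradicted. Used at \<open>2 ^ k\<close> and then squared, it gives quadratic growth at exponent
  \<open>2 ^ Suc k\<close>.\<close>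

lemma power_two_power_le_linear_imp_le_one:
  fixes r c :: real
  assumes "r \<ge> 0" "c \<ge> 0" "\<And>k::nat. r ^ (2 ^ k) \<le> 1 + 2 ^ k * c"
  shows "r \<le> 1"
proof (rule ccontr)
  assume "\<not> r \<le> 1"
  define d where "d = r - 1"
  have d: "d > 0" using \<open>\<not> r \<le> 1\<close> by (simp add: d_def)
  have "(1::real) < 2" by simp
  from real_arch_pow[OF this] obtain k :: nat where k: "(1 + 2 * c) / d\<^sup>2 < 2 ^ k" by blast
  define N :: real where "N = 2 ^ k"
  have N: "N \<ge> 1" by (simp add: N_def)
  have "1 + 2 ^ k * d \<le> r ^ (2 ^ k)"
    using Bernoulli_inequality[of d "2 ^ k"] d by (simp add: d_def)
  then have "(1 + N * d)\<^sup>2 \<le> (r ^ (2 ^ k))\<^sup>2" using d N by (intro power_mono) (auto simp: N_def)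
  also have "\<dots> = r ^ (2 ^ Suc k)" by (simp add: power_mult[symmetric] mult.commute)
  also have "\<dots> \<le> 1 + 2 * N * c" using assms(3)[of "Suc k"] by (simp add: N_def)
  finally have "N * (N * d\<^sup>2) \<le> 2 * N * c - 2 * N * d" by (simp add: power2_eq_square algebra_simps)
  also have "\<dots> \<le> N * (1 + 2 * c)" using d N by (simp add: algebra_simps mult_nonneg_nonneg)
  finally have "N * d\<^sup>2 \<le> 1 + 2 * c" using N by simp
  then show False using k d by (simp add: N_def field_simps)
qed

text \<open>Elementary substitute for \<open>spec (z* z) \<union> {0} = spec (z z*) \<union> {0}\<close>: compare norms of large powers.\<close>

lemma neg_pos_adj_mult_swap:
  fixes z :: "'a::unital_cstar_algebra"
  assumes "pos (- (adj z * z))"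
  shows "pos (- (z * adj z))"
proof -
  obtain t where t: "t \<ge> 0" "norm (t *\<^sub>R 1 + adj z * z) \<le> t" using assms unfolding pos_def by auto
  show ?thesis
  proof (cases "t = 0")
    case True
    then have "adj z * z = 0" using t by simp
    then have "z = 0" by (rule adj_mult_self_eq_0)
    then show ?thesis by simp
  next
    case False
    with t have "t > 0" by simp
    define p where "p = t *\<^sub>R 1 + z * adj z"
    have sa: "adj p = p" by (simp add: p_def adj_simps)
    \<comment> \<open>With \<open>norm f \<le> n * t ^ n / t\<close>, the term
      \<open>z * f * adj z\<close> has norm at most \<open>t ^ n * (n * c)\<close>.\<close>
    define c where "c = norm z * norm z / t"
    have "(norm p / t) ^ (2 ^ k) \<le> 1 + 2 ^ k * c" for k :: nat
    proof -
      define n :: nat where "n = 2 ^ k"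
      obtain f where f: "p ^ n = t ^ n *\<^sub>R 1 + z * f * adj z" "t * norm f \<le> n * t ^ n"
        using power_shift_expansion[OF t(2,1)] unfolding p_def by blast
      have nf: "norm f \<le> n * t ^ n / t" using f(2) \<open>t > 0\<close> by (simp add: field_simps)
      have "norm p ^ n = norm (p ^ n)" using norm_power_selfadj[OF sa] by (simp add: n_def)
      also have "\<dots> \<le> t ^ n + norm (z * f * adj z)"
        unfolding f(1) using norm_triangle_ineq[of "t ^ n *\<^sub>R 1" "z * f * adj z"] t(1) by simp
      also have "norm (z * f * adj z) \<le> norm z * norm f * norm z"
        by (metis norm_adj norm_mult_ineq mult_right_mono norm_ge_zero order_trans)
      also have "\<dots> \<le> norm z * (n * t ^ n / t) * norm z"
        using nf by (intro mult_right_mono mult_left_mono) auto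
      finally have "norm p ^ n \<le> t ^ n * (1 + n * c)"
        by (simp add: c_def field_simps)
      then show ?thesis using \<open>t > 0\<close> by (simp add: n_def power_divide field_simps)
    qed
    moreover have "norm p / t \<ge> 0" "c \<ge> 0" using \<open>t > 0\<close> by (auto simp: c_def)
    ultimately have "norm p / t \<le> 1" using power_two_power_le_linear_imp_le_one by blast
    then show ?thesis using \<open>t > 0\<close>
      by (intro posI[of _ t]) (auto simp: p_def adj_simps)
  qed
qed

text \<open>\<open>adj z * z + z * adj z\<close> is half a sum of two self-adjoint squares, hence
  positive. Adding the positive \<open>- (z * adj z)\<close> shows \<open>adj z * z\<close> positive
  as well as negative.\<close>

lemma neg_pos_adj_mult_eq_0:
  fixes z :: "'a::unital_cstar_algebra"
  assumes "pos (- (adj z * z))" shows "z = 0"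
proof -
  define a where "a = z + adj z"
  define b where "b = \<i> *\<^sub>C (z - adj z)"
  have a: "adj a = a" by (simp add: a_def adj_simps add.commute)
  have b: "adj b = b"
    using scaleC_scaleC[of "-1" \<i> "adj z - z"]
    by (simp add: b_def adj_simps scaleC_minus_one flip: scaleC_minus_right)
  have "b * b = - ((z - adj z) * (z - adj z))"
    unfolding b_def mult_scaleC_left mult_scaleC_right scaleC_scaleC by (simp add: scaleC_minus_one)
  then have "a * a + b * b = 2 *\<^sub>R (adj z * z + z * adj z)"
    by (simp add: a_def scaleR_2 algebra_simps)
  then have "adj z * z + z * adj z = (1 / 2) *\<^sub>R (a * a + b * b)" by simp
  moreover have "pos ((1 / 2) *\<^sub>R (a * a + b * b))"
    by (intro pos_scaleR pos_add pos_square a b) simp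
  ultimately have "pos ((adj z * z + z * adj z) + (- (z * adj z)))"
    using neg_pos_adj_mult_swap[OF assms] by (metis pos_add)
  then have "pos (adj z * z)" by simp
  from pos_antisym[OF this assms] show ?thesis by (rule adj_mult_self_eq_0)
qed

text \<open>Kaplansky's argument with \<open>k = |y| - y\<close> in place of the negative part of \<open>y = x* x\<close>: for \<open>z = x k\<close>
  one has \<open>z* z = k y k = - k |y| k\<close>, which forces \<open>k = 0\<close>.\<close>

theorem pos_adj_mult: "pos (adj x * x)" for x :: "'a::unital_cstar_algebra"
proof -
  define y where "y = adj x * x"
  have y: "adj y = y" by (simp add: y_def adj_simps)
  obtain s where s: "pos s" "s * s = y * y" "\<forall>w. w * (y * y) = y * y * w \<longrightarrow> w * s = s * w"
    by (rule pos_sqrt[OF pos_square[OF y]])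
  \<comment> \<open>The root \<open>r\<close> of \<open>s\<close>, which plays the role of
    \<open>|y|\<close>, turns \<open>k * s * k\<close> into the square of \<open>r * k\<close>; this
    is self-adjoint because \<open>r\<close> commutes with \<open>k\<close>.\<close>
  obtain r where r: "pos r" "r * r = s" "\<forall>w. w * s = s * w \<longrightarrow> w * r = r * w"
    by (rule pos_sqrt[OF s(1)])
  have ys: "y * s = s * y" by (intro s(3)[rule_format]) (simp add: mult.assoc)
  define k where "k = s - y"
  have k: "adj k = k" using y s(1) by (simp add: k_def adj_simps pos_selfadj)
  have kr: "k * r = r * k" by (intro r(3)[rule_format]) (simp add: k_def ys algebra_simps)
  have yk: "y * k = - (s * k)" by (simp add: k_def algebra_simps ys s(2))
  have "adj (x * k) * (x * k) = k * (y * k)" by (simp add: k y_def adj_simps mult.assoc)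
  also have "\<dots> = - (k * r * (r * k))" by (simp add: yk mult.assoc flip: r(2))
  finally have "- (adj (x * k) * (x * k)) = adj (r * k) * (r * k)"
    using r(1) by (simp add: k adj_simps pos_selfadj)
  moreover have "adj (r * k) = r * k" using r(1) by (simp add: k kr adj_simps pos_selfadj)
  ultimately have pz: "- (adj (x * k) * (x * k)) = r * k * (r * k)" and "pos (r * k * (r * k))"
    using pos_square by metis+
  then have "x * k = 0" using neg_pos_adj_mult_eq_0 by metis
  then have yk0: "y * k = 0" by (simp add: y_def mult.assoc)
  then have "s * k = 0" using yk by simp
  then have "k * k = 0" using yk0 by (simp add: k_def algebra_simps)
  then have "k = 0" using adj_mult_self_eq_0[of k] k by simp
  then show ?thesis using s(1) by (simp add: k_def y_def)
qed

lemma pos_conj: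
  fixes h v :: "'a::unital_cstar_algebra"
  assumes "pos h" shows "pos (adj v * h * v)"
proof -
  obtain s where s: "pos s" "s * s = h" "\<forall>w. w * h = h * w \<longrightarrow> w * s = s * w"
    by (rule pos_sqrt[OF assms])
  have "adj (s * v) * (s * v) = adj v * h * v"
    by (simp add: adj_simps pos_selfadj[OF s(1)] mult.assoc flip: s(2))
  then show ?thesis by (metis pos_adj_mult)
qed

section \<open>Order inequalities and inverses in the algebra\<close>

lemma pos_scaleR_adj_mult_diff:
  fixes x v :: "'a::unital_cstar_algebra"
  assumes "norm x \<le> M"
  shows "pos (M\<^sup>2 *\<^sub>R (adj v * v) - adj (x * v) * (x * v))"
proof -
  have "pos (norm (adj x * x) *\<^sub>R 1 - adj x * x)"
    by (rule pos_norm_minus) (simp add: adj_simps)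
  moreover have "pos ((M\<^sup>2 - norm (adj x * x)) *\<^sub>R (1::'a))"
    using assms by (intro pos_scaleR_one) (simp add: cstar_identity power_mono)
  ultimately have "pos ((M\<^sup>2 - norm (adj x * x)) *\<^sub>R 1 + (norm (adj x * x) *\<^sub>R 1 - adj x * x))"
    by (rule pos_add[rotated])
  then have "pos (M\<^sup>2 *\<^sub>R 1 - adj x * x)" by (simp add: scaleR_diff_left)
  from pos_conj[OF this, of v] show ?thesis by (simp add: adj_simps algebra_simps)
qed

text \<open>Cauchy-Schwarz with values in the algebra: the difference is half the double sum of the
  squares of \<open>u i - u j\<close>.\<close>

lemma pos_sum_square_diff:
  fixes u :: "'i \<Rightarrow> 'a::unital_cstar_algebra"
  shows "pos (real (card J) *\<^sub>R (\<Sum>j\<in>J. adj (u j) * u j) - adj (\<Sum>j\<in>J. u j) * (\<Sum>j\<in>J. u j))"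
proof -
  have "pos ((1 / 2) *\<^sub>R (\<Sum>i\<in>J. \<Sum>j\<in>J. adj (u i - u j) * (u i - u j)))"
    by (intro pos_scaleR pos_sum pos_adj_mult) simp
  also have "(\<Sum>i\<in>J. \<Sum>j\<in>J. adj (u i - u j) * (u i - u j)) =
      (real (card J) *\<^sub>R (\<Sum>j\<in>J. adj (u j) * u j) - adj (\<Sum>j\<in>J. u j) * (\<Sum>j\<in>J. u j)) +
      (real (card J) *\<^sub>R (\<Sum>j\<in>J. adj (u j) * u j) - adj (\<Sum>j\<in>J. u j) * (\<Sum>j\<in>J. u j))"
  proof -
    have "(\<Sum>i\<in>J. \<Sum>j\<in>J. adj (u i) * u j) = adj (\<Sum>j\<in>J. u j) * (\<Sum>j\<in>J. u j)"
      by (simp add: adj_sum sum_product)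
    moreover have "(\<Sum>i\<in>J. \<Sum>j\<in>J. adj (u j) * u i) = adj (\<Sum>j\<in>J. u j) * (\<Sum>j\<in>J. u j)"
      by (subst sum.swap) (simp add: adj_sum sum_product)
    ultimately show ?thesis
      by (simp add: adj_simps algebra_simps sum.distrib sum_subtractf sum_constant_scaleR
          del: sum_constant flip: scaleR_sum_right)
  qed
  finally show ?thesis by simp
qed

text \<open>Operator form of \<open>2 * b * h * c \<le> M * (b\<^sup>2 + c\<^sup>2)\<close>, by
  completing the square with \<open>w = b - h * c / M\<close>; what remains is
  \<open>adj (h * c) * (h * c) \<le> M\<^sup>2 * (adj c * c)\<close>, divided by
  \<open>M\<close>.\<close>

lemma pos_scaleR_squares_diff:
  fixes b c h :: "'a::unital_cstar_algebra"
  assumes "norm h \<le> M"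
  shows "pos (M *\<^sub>R (adj b * b + adj c * c) - (adj b * h * c + adj c * adj h * b))"
proof (cases "M = 0")
  case True
  then show ?thesis using assms by simp
next
  case False
  then have M: "M > 0" using assms norm_ge_zero[of h] by linarith
  define w where "w = b - (1 / M) *\<^sub>R (h * c)"
  have "pos (M *\<^sub>R (adj w * w) + (1 / M) *\<^sub>R (M\<^sup>2 *\<^sub>R (adj c * c) - adj (h * c) * (h * c)))"
    using M by (intro pos_add pos_scaleR pos_adj_mult pos_scaleR_adj_mult_diff assms) auto
  also have "M *\<^sub>R (adj w * w) + (1 / M) *\<^sub>R (M\<^sup>2 *\<^sub>R (adj c * c) - adj (h * c) * (h * c)) =
      M *\<^sub>R (adj b * b + adj c * c) - (adj b * h * c + adj c * adj h * b)"
    using M by (simp add: w_def adj_simps algebra_simps power2_eq_square)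
  finally show ?thesis .
qed

text \<open>Write \<open>a = (t + e) * (1 - k)\<close> with \<open>norm k < 1\<close>. In place of a
  Neumann series, Banach's fixed point theorem for \<open>x \<mapsto> 1 + k * x\<close> gives a
  right inverse, and self-adjointness of \<open>a\<close> makes it two-sided.\<close>

lemma pos_inverse:
  fixes a :: "'a::unital_cstar_algebra"
  assumes "pos (a - e *\<^sub>R 1)" "e > 0"
  obtains b where "pos b" "a * b = 1" "b * a = 1"
proof -
  obtain t where t: "t \<ge> 0" "norm (t *\<^sub>R 1 - (a - e *\<^sub>R 1)) \<le> t" using assms(1) unfolding pos_def by blast
  have "pos ((a - e *\<^sub>R 1) + e *\<^sub>R 1)" using assms by (intro pos_add pos_scaleR_one) auto
  then have a: "pos a" by simp
  define k where "k = 1 - (1 / (t + e)) *\<^sub>R a"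
  have "norm ((1 / (t + e)) *\<^sub>R (t *\<^sub>R 1 - (a - e *\<^sub>R 1))) \<le> t / (t + e)"
    using t assms(2) by (simp add: divide_right_mono)
  moreover have "(1 / (t + e)) *\<^sub>R (t *\<^sub>R 1 - (a - e *\<^sub>R 1)) = k"
    using t assms(2) by (simp add: k_def scaleR_diff_right add_divide_distrib[symmetric]
        algebra_simps flip: scaleR_add_left)
  ultimately have "norm k \<le> t / (t + e)" by simp
  also have "t / (t + e) < 1" using t(1) assms(2) by simp
  finally have k: "norm k < 1" .
  have "dist (1 + k * x) (1 + k * y) \<le> norm k * dist x y" for x y
    using norm_mult_ineq[of k "x - y"] by (simp add: dist_norm right_diff_distrib)
  then obtain x where x: "1 + k * x = x"
    using banach_fix_type[of "norm k" "\<lambda>x. 1 + k * x"] k by auto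
  have ab: "a * ((1 / (t + e)) *\<^sub>R x) = 1"
  proof -
    have "1 = (1 - k) * x" using x by (simp add: algebra_simps)
    then show ?thesis by (simp add: k_def)
  qed
  define b where "b = (1 / (t + e)) *\<^sub>R x"
  have "adj (a * b) = 1" using ab by (simp add: b_def)
  then have ba: "adj b * a = 1" using a by (simp add: adj_simps pos_selfadj)
  have "adj b = adj b * (a * b)" using ab by (simp add: b_def)
  also have "\<dots> = b" using ba by (simp flip: mult.assoc)
  finally have sb: "adj b = b" .
  \<comment> \<open>This element equals \<open>b\<close>.\<close>
  have "pos (adj b * a * b)" using a by (rule pos_conj)
  then have "pos b" using ba by simp
  then show ?thesis using that ab ba sb by (simp add: b_def)
qed

section \<open>Positive matrices are sums of squares of rows\<close>

text \<open>Cholesky factorization: the form of a Schur complement is the given form at vectors whose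
  \<open>p\<close>-th entry minimizes it, so strict positivity is inherited with the same \<open>e\<close>.\<close>

lemma cholesky:
  fixes a :: "'i \<Rightarrow> 'i \<Rightarrow> 'a::unital_cstar_algebra"
  assumes "finite I" "e > 0" "\<And>i j. i \<in> I \<Longrightarrow> j \<in> I \<Longrightarrow> adj (a i j) = a j i"
    and "\<And>b. pos ((\<Sum>i\<in>I. \<Sum>j\<in>I. adj (b i) * a i j * b j) - e *\<^sub>R (\<Sum>i\<in>I. adj (b i) * b i))"
  shows "\<exists>z. \<forall>i\<in>I. \<forall>j\<in>I. a i j = (\<Sum>k\<in>I. adj (z k i) * z k j)"
  using assms
proof (induction I arbitrary: a rule: finite_induct)
  case (insert p I)
  note herm = insert.prems(2) and form = insert.prems(3)
  \<comment> \<open>At the \<open>p\<close>-th basis vector the form reduces to the diagonal entry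
    \<open>a p p\<close>; these are the terms that vanish.\<close>
  have "(\<Sum>i\<in>I. \<Sum>j\<in>insert p I. adj (if i = p then 1 else 0) * a i j * (if j = p then 1 else 0)) = 0"
    "(\<Sum>j\<in>I. adj 1 * a p j * (if j = p then 1 else 0)) = 0"
    "(\<Sum>i\<in>I. adj (if i = p then 1 else 0) * (if i = p then 1 else 0 :: 'a)) = 0"
    using insert.hyps by (auto intro!: sum.neutral)
  then have "pos (a p p - e *\<^sub>R 1)"
    using form[of "\<lambda>i. if i = p then 1 else 0"] insert.hyps by simp
  then obtain \<beta> where \<beta>: "pos \<beta>" "a p p * \<beta> = 1" "\<beta> * a p p = 1"
    using \<open>e > 0\<close> by (rule pos_inverse)
  note \<beta>sa = pos_selfadj[OF \<beta>(1)]
  obtain \<sigma> where \<sigma>: "pos \<sigma>" "\<sigma> * \<sigma> = \<beta>" "\<forall>w. w * \<beta> = \<beta> * w \<longrightarrow> w * \<sigma> = \<sigma> * w"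
    by (rule pos_sqrt[OF \<beta>(1)])
  define S where "S i j = a i j - a i p * \<beta> * a p j" for i j
  have "\<exists>z. \<forall>i\<in>I. \<forall>j\<in>I. S i j = (\<Sum>k\<in>I. adj (z k i) * z k j)"
  proof (rule insert.IH[OF \<open>e > 0\<close>])
    show "adj (S i j) = S j i" if "i \<in> I" "j \<in> I" for i j
      using that herm by (simp add: S_def adj_simps \<beta>sa mult.assoc)
  next
    fix b
    define w where "w = (\<Sum>j\<in>I. a p j * b j)"
    define b' where "b' i = (if i = p then - (\<beta> * w) else b i)" for i
    have adjw: "adj w = (\<Sum>i\<in>I. adj (b i) * a i p)"
      unfolding w_def adj_sum by (intro sum.cong) (auto simp: adj_mult herm)
    have b'I: "b' i = b i" if "i \<in> I" for i using that insert.hyps by (auto simp: b'_def)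
    have b'p: "b' p = - (\<beta> * w)" by (simp add: b'_def)
    define F where "F = (\<Sum>i\<in>I. \<Sum>j\<in>I. adj (b i) * a i j * b j)"
    define N where "N = (\<Sum>i\<in>I. adj (b i) * b i)"
    have wbw: "adj w * \<beta> * w = (\<Sum>i\<in>I. \<Sum>j\<in>I. adj (b i) * a i p * \<beta> * (a p j * b j))"
      unfolding adjw sum_distrib_right by (simp add: w_def sum_distrib_left)
    have FS: "(\<Sum>i\<in>I. \<Sum>j\<in>I. adj (b i) * S i j * b j) = F - adj w * \<beta> * w"
      unfolding S_def F_def wbw by (simp add: algebra_simps sum_subtractf)
    have "(\<Sum>i\<in>insert p I. \<Sum>j\<in>insert p I. adj (b' i) * a i j * b' j) =
        adj (b' p) * a p p * b' p + adj (b' p) * w + adj w * b' p + F"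
      using insert.hyps b'I
      by (simp add: sum.distrib F_def w_def adjw[unfolded w_def] sum_distrib_left sum_distrib_right
          mult.assoc)
    also have "\<dots> = F - adj w * \<beta> * w"
    proof -
      have "adj (b' p) * a p p = - adj w" using \<beta> by (simp add: b'p adj_simps \<beta>sa mult.assoc)
      then show ?thesis by (simp add: b'p adj_simps \<beta>sa mult.assoc)
    qed
    finally have "pos (F - adj w * \<beta> * w - e *\<^sub>R (adj (b' p) * b' p + N))"
      using form[of b'] insert.hyps b'I by (simp add: N_def)
    moreover have "pos (e *\<^sub>R (adj (b' p) * b' p))"
      using \<open>e > 0\<close> by (intro pos_scaleR pos_adj_mult) simp
    ultimately have "pos (F - adj w * \<beta> * w - e *\<^sub>R (adj (b' p) * b' p + N) + e *\<^sub>R (adj (b' p) * b' p))"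
      by (rule pos_add)
    then show "pos ((\<Sum>i\<in>I. \<Sum>j\<in>I. adj (b i) * S i j * b j) - e *\<^sub>R (\<Sum>i\<in>I. adj (b i) * b i))"
      unfolding FS N_def[symmetric] by (simp add: scaleR_add_right)
  qed
  then obtain z where z: "\<And>i j. i \<in> I \<Longrightarrow> j \<in> I \<Longrightarrow> S i j = (\<Sum>k\<in>I. adj (z k i) * z k j)" by blast
  \<comment> \<open>One elimination step: row \<open>p\<close> of the factor reproduces row and
    column \<open>p\<close> of \<open>a\<close>, and the other rows, zero in column
    \<open>p\<close>, factorize the Schur complement \<open>S\<close>.\<close>
  define z' where "z' k j = (if k = p then \<sigma> * a p j else if j = p then 0 else z k j)" for k j
  have "a i j = (\<Sum>k\<in>insert p I. adj (z' k i) * z' k j)" if "i \<in> insert p I" "j \<in> insert p I" for i j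
  proof -
    have "adj (z' p i) * z' p j = a i p * \<beta> * a p j"
      using that(1) pos_selfadj[OF \<sigma>(1)] by (simp add: z'_def adj_simps herm mult.assoc flip: \<sigma>(2))
    moreover have "(\<Sum>k\<in>I. adj (z' k i) * z' k j) = a i j - a i p * \<beta> * a p j"
    proof (cases "i = p \<or> j = p")
      case True
      then have "adj (z' k i) * z' k j = 0" if "k \<in> I" for k
        using that insert.hyps by (auto simp: z'_def)
      moreover have "a i j - a i p * \<beta> * a p j = 0" 
        using True \<beta> by (auto simp: mult.assoc) (simp flip: mult.assoc)
      ultimately show ?thesis by simp
    next
      case False
      then have "i \<in> I" "j \<in> I" using that by auto
      then have "S i j = (\<Sum>k\<in>I. adj (z' k i) * z' k j)"
        unfolding z[OF \<open>i \<in> I\<close> \<open>j \<in> I\<close>] using insert.hyps False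
        by (intro sum.cong) (auto simp: z'_def)
      then show ?thesis by (simp add: S_def)
    qed
    ultimately show ?thesis using insert.hyps by simp
  qed
  then show ?case by blast
qed simp

section \<open>Positive functionals on matrices, given by their entries\<close>

lemma linear_CD:
  fixes f :: "'a::unital_cstar_algebra \<Rightarrow> 'b::unital_cstar_algebra"
  assumes "linear_C f"
  shows linear_C_add: "f (x + y) = f x + f y"
    and linear_C_scaleC: "f (c *\<^sub>C x) = c *\<^sub>C f x"
    and linear_C_scaleR: "f (r *\<^sub>R x) = r *\<^sub>R f x"
    and linear_C_zero: "f 0 = 0"
    and linear_C_minus: "f (- x) = - f x"
    and linear_C_diff: "f (x - y) = f x - f y"
    and linear_C_sum: "f (\<Sum>i\<in>I. g i) = (\<Sum>i\<in>I. f (g i))"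
proof -
  show add: "f (x + y) = f x + f y" for x y using assms by (simp add: linear_C_def)
  show sc: "f (c *\<^sub>C x) = c *\<^sub>C f x" for c x using assms by (simp add: linear_C_def)
  show "f (r *\<^sub>R x) = r *\<^sub>R f x" by (simp add: scaleR_eq_scaleC sc)
  show zero: "f 0 = 0" using sc[of 0 0] by simp
  show minus: "f (- x) = - f x" for x using sc[of "-1" x] by (simp add: scaleC_minus_one)
  show "f (x - y) = f x - f y" using add[of x "- y"] by (simp add: minus)
  show "f (\<Sum>i\<in>I. g i) = (\<Sum>i\<in>I. f (g i))"
    by (induction I rule: infinite_finite_induct) (auto simp: zero add)
qed

text \<open>Encodes a positive functional on the matrices indexed by \<open>I\<close> by its restrictions \<open>m i j\<close> to
  single entries. Positivity at \<open>Z* Z\<close> reduces to the rows \<open>z\<close> of \<open>Z\<close>.\<close>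

definition pos_functional :: "'i set \<Rightarrow> ('i \<Rightarrow> 'i \<Rightarrow> 'a::unital_cstar_algebra \<Rightarrow> complex) \<Rightarrow> bool" where
  "pos_functional I m \<longleftrightarrow> (\<forall>i\<in>I. \<forall>j\<in>I. linear_C (m i j))
     \<and> (\<forall>z. (\<Sum>i\<in>I. \<Sum>j\<in>I. m i j (adj (z i) * z j)) \<in> \<real>\<^sub>\<ge>\<^sub>0)"

lemma nonneg_Reals_sum: "(\<And>i. i \<in> I \<Longrightarrow> f i \<in> \<real>\<^sub>\<ge>\<^sub>0) \<Longrightarrow> (\<Sum>i\<in>I. f i) \<in> (\<real>\<^sub>\<ge>\<^sub>0 :: complex set)"
  by (induction I rule: infinite_finite_induct) auto

lemma pos_functional_one:
  assumes "finite I" "pos_functional I m" "i \<in> I"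
  shows "m i i 1 \<in> \<real>\<^sub>\<ge>\<^sub>0"
proof -
  define z where "z j = (if j = i then 1 else 0 :: 'b)" for j
  have "m k j (adj (z k) * z j) = (if j = i then if k = i then m i i 1 else 0 else 0)"
    if "k \<in> I" "j \<in> I" for k j
    using assms(2) that linear_C_zero[of "m k j"] by (auto simp: z_def pos_functional_def)
  then have "(\<Sum>k\<in>I. \<Sum>j\<in>I. m k j (adj (z k) * z j)) = m i i 1"
    using assms(1,3) by (simp add: sum.delta cong: sum.cong)
  then show ?thesis using assms(2) unfolding pos_functional_def by metis
qed

text \<open>After adding \<open>e\<close> times the unit matrix, Cholesky writes the matrix as a sum
  over rows, whence \<open>S + e * T\<close> is nonnegative. Taking \<open>e = 1\<close> shows that
  \<open>S\<close> is real, small \<open>e\<close> that it is nonnegative.\<close>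

lemma pos_functional_nonneg:
  fixes a :: "'i \<Rightarrow> 'i \<Rightarrow> 'a::unital_cstar_algebra"
  assumes I: "finite I" and m: "pos_functional I m"
    and herm: "\<And>i j. i \<in> I \<Longrightarrow> j \<in> I \<Longrightarrow> adj (a i j) = a j i"
    and form: "\<And>b. pos (\<Sum>i\<in>I. \<Sum>j\<in>I. adj (b i) * a i j * b j)"
  shows "(\<Sum>i\<in>I. \<Sum>j\<in>I. m i j (a i j)) \<in> \<real>\<^sub>\<ge>\<^sub>0"
proof -
  define S where "S = (\<Sum>i\<in>I. \<Sum>j\<in>I. m i j (a i j))"
  define T where "T = (\<Sum>i\<in>I. m i i 1)"
  have T: "T \<in> \<real>\<^sub>\<ge>\<^sub>0" unfolding T_def by (intro nonneg_Reals_sum pos_functional_one[OF I m])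
  have lin: "linear_C (m i j)" if "i \<in> I" "j \<in> I" for i j
    using m that by (simp add: pos_functional_def)
  have S: "S + complex_of_real e * T \<in> \<real>\<^sub>\<ge>\<^sub>0" if "e > 0" for e
  proof -
    define a' where "a' i j = a i j + (if i = j then e *\<^sub>R 1 else 0)" for i j
    have "\<exists>z. \<forall>i\<in>I. \<forall>j\<in>I. a' i j = (\<Sum>k\<in>I. adj (z k i) * z k j)"
    proof (rule cholesky[OF I that])
      show "adj (a' i j) = a' j i" if "i \<in> I" "j \<in> I" for i j
        using herm[OF that] by (auto simp: a'_def adj_simps)
      fix b :: "'i \<Rightarrow> 'a"
      have "(\<Sum>j\<in>I. adj (b i) * a' i j * b j) = (\<Sum>j\<in>I. adj (b i) * a i j * b j) + e *\<^sub>R (adj (b i) * b i)"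
        if "i \<in> I" for i
      proof -
        have "(\<Sum>j\<in>I. adj (b i) * a' i j * b j) = (\<Sum>j\<in>I. adj (b i) * a i j * b j) +
            (\<Sum>j\<in>I. if i = j then e *\<^sub>R (adj (b i) * b j) else 0)"
          unfolding sum.distrib[symmetric] by (intro sum.cong) (auto simp: a'_def algebra_simps)
        then show ?thesis using I that by (simp add: sum.delta')
      qed
      then show "pos ((\<Sum>i\<in>I. \<Sum>j\<in>I. adj (b i) * a' i j * b j) - e *\<^sub>R (\<Sum>i\<in>I. adj (b i) * b i))"
        using form[of b] by (simp add: sum.distrib scaleR_sum_right)
    qed
    then obtain z where z: "\<And>i j. i \<in> I \<Longrightarrow> j \<in> I \<Longrightarrow> a' i j = (\<Sum>k\<in>I. adj (z k i) * z k j)" by blast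
    have "(\<Sum>i\<in>I. \<Sum>j\<in>I. m i j (a' i j)) = (\<Sum>i\<in>I. \<Sum>j\<in>I. \<Sum>k\<in>I. m i j (adj (z k i) * z k j))"
      by (intro sum.cong refl) (simp add: z linear_C_sum[OF lin])
    also have "\<dots> = (\<Sum>i\<in>I. \<Sum>k\<in>I. \<Sum>j\<in>I. m i j (adj (z k i) * z k j))"
      by (rule sum.cong[OF refl]) (rule sum.swap)
    also have "\<dots> = (\<Sum>k\<in>I. \<Sum>i\<in>I. \<Sum>j\<in>I. m i j (adj (z k i) * z k j))" by (rule sum.swap)
    also have "\<dots> \<in> \<real>\<^sub>\<ge>\<^sub>0"
      by (rule nonneg_Reals_sum) (use m in \<open>simp add: pos_functional_def\<close>)
    finally have "(\<Sum>i\<in>I. \<Sum>j\<in>I. m i j (a' i j)) \<in> \<real>\<^sub>\<ge>\<^sub>0" .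
    moreover have "(\<Sum>i\<in>I. \<Sum>j\<in>I. m i j (a' i j)) = S + complex_of_real e * T"
    proof -
      have "(\<Sum>j\<in>I. m i j (a' i j)) = (\<Sum>j\<in>I. m i j (a i j)) + complex_of_real e * m i i 1"
        if i: "i \<in> I" for i
      proof -
        have "(\<Sum>j\<in>I. m i j (a' i j)) = (\<Sum>j\<in>I. m i j (a i j)) +
            (\<Sum>j\<in>I. if i = j then complex_of_real e * m i i 1 else 0)"
          unfolding sum.distrib[symmetric] using lin[OF i]
          by (intro sum.cong) (auto simp: a'_def linear_CD scaleR_conv_of_real[where 'a = complex])
        then show ?thesis using I i by (simp add: sum.delta')
      qed
      then show ?thesis by (simp add: S_def T_def sum.distrib sum_distrib_left)
    qed
    ultimately show ?thesis by simp
  qed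
  have "Im S = 0" using S[of 1] T by (simp add: complex_nonneg_Reals_iff)
  moreover have "Re S \<ge> 0"
  proof (rule field_le_epsilon)
    fix \<epsilon> :: real assume "\<epsilon> > 0"
    \<comment> \<open>Chosen so that \<open>e * Re T \<le> \<epsilon>\<close>; the summand 1 keeps
      the denominator positive.\<close>
    define e where "e = \<epsilon> / (Re T + 1)"
    have rT: "Re T \<ge> 0" using T by (simp add: complex_nonneg_Reals_iff)
    then have e: "e > 0" using \<open>\<epsilon> > 0\<close> by (simp add: e_def)
    have "0 \<le> Re S + e * Re T" using S[OF e] by (simp add: complex_nonneg_Reals_iff)
    moreover have "e * Re T \<le> \<epsilon>" using rT \<open>\<epsilon> > 0\<close> by (simp add: e_def field_simps)
    ultimately show "0 \<le> Re S + \<epsilon>" by linarith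
  qed
  ultimately show ?thesis by (simp add: S_def complex_nonneg_Reals_iff)
qed

text \<open>The matrix \<open>K - h\<close> has positive form: grouping the \<open>(i, j)\<close>
  term with its adjoint, a pair costs at most
  \<open>M * (adj (b i) * b i + adj (b j) * b j)\<close>. Half the double sum of these counts each
  square \<open>card I\<close> times.\<close>

lemma pos_functional_selfadj_bound:
  fixes h :: "'i \<Rightarrow> 'i \<Rightarrow> 'a::unital_cstar_algebra"
  assumes I: "finite I" and m: "pos_functional I m"
    and herm: "\<And>i j. i \<in> I \<Longrightarrow> j \<in> I \<Longrightarrow> adj (h i j) = h j i"
    and h: "\<And>i j. i \<in> I \<Longrightarrow> j \<in> I \<Longrightarrow> norm (h i j) \<le> M"
  shows "of_real (real (card I) * M) * (\<Sum>i\<in>I. m i i 1) - (\<Sum>i\<in>I. \<Sum>j\<in>I. m i j (h i j)) \<in> \<real>\<^sub>\<ge>\<^sub>0"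
proof -
  define K where "K = real (card I) * M"
  define a where "a i j = (if i = j then K *\<^sub>R 1 else 0) - h i j" for i j
  have lin: "linear_C (m i j)" if "i \<in> I" "j \<in> I" for i j
    using m that by (simp add: pos_functional_def)
  have "(\<Sum>i\<in>I. \<Sum>j\<in>I. m i j (a i j)) \<in> \<real>\<^sub>\<ge>\<^sub>0"
  proof (rule pos_functional_nonneg[OF I m])
    show "adj (a i j) = a j i" if "i \<in> I" "j \<in> I" for i j
      using herm[OF that] by (auto simp: a_def adj_simps)
    fix b :: "'i \<Rightarrow> 'a"
    define N where "N = (\<Sum>i\<in>I. adj (b i) * b i)"
    define F where "F = (\<Sum>i\<in>I. \<Sum>j\<in>I. adj (b i) * h i j * b j)"
    have "pos ((1 / 2) *\<^sub>R (\<Sum>i\<in>I. \<Sum>j\<in>I. M *\<^sub>R (adj (b i) * b i + adj (b j) * b j)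
        - (adj (b i) * h i j * b j + adj (b j) * adj (h i j) * b i)))"
      using h by (intro pos_scaleR pos_sum pos_scaleR_squares_diff) auto
    also have "(\<Sum>i\<in>I. \<Sum>j\<in>I. M *\<^sub>R (adj (b i) * b i + adj (b j) * b j)
        - (adj (b i) * h i j * b j + adj (b j) * adj (h i j) * b i)) = (K *\<^sub>R N - F) + (K *\<^sub>R N - F)"
    proof -
      have "(\<Sum>i\<in>I. \<Sum>j\<in>I. adj (b j) * adj (h i j) * b i) = F"
        unfolding F_def by (subst sum.swap) (intro sum.cong refl, simp add: herm)
      then show ?thesis
        by (simp add: sum.distrib sum_subtractf scaleR_add_right K_def sum_constant_scaleR
            N_def F_def algebra_simps del: sum_constant flip: scaleR_sum_right)
    qed
    finally have "pos (K *\<^sub>R N - F)" by simp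
    moreover have "(\<Sum>i\<in>I. \<Sum>j\<in>I. adj (b i) * a i j * b j) = K *\<^sub>R N - F"
    proof -
      have "(\<Sum>j\<in>I. adj (b i) * a i j * b j) = K *\<^sub>R (adj (b i) * b i) - (\<Sum>j\<in>I. adj (b i) * h i j * b j)"
        if "i \<in> I" for i
      proof -
        have "(\<Sum>j\<in>I. adj (b i) * a i j * b j) =
            (\<Sum>j\<in>I. if i = j then K *\<^sub>R (adj (b i) * b j) else 0) - (\<Sum>j\<in>I. adj (b i) * h i j * b j)"
          unfolding sum_subtractf[symmetric] by (intro sum.cong) (auto simp: a_def algebra_simps)
        then show ?thesis using I that by (simp add: sum.delta')
      qed
      then show ?thesis by (simp add: sum_subtractf N_def F_def scaleR_sum_right)
    qed
    ultimately show "pos (\<Sum>i\<in>I. \<Sum>j\<in>I. adj (b i) * a i j * b j)" by simp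
  qed
  moreover have "(\<Sum>j\<in>I. m i j (a i j)) = of_real K * m i i 1 - (\<Sum>j\<in>I. m i j (h i j))"
    if i: "i \<in> I" for i
  proof -
    have "(\<Sum>j\<in>I. m i j (a i j)) =
        (\<Sum>j\<in>I. if i = j then of_real K * m i i 1 else 0) - (\<Sum>j\<in>I. m i j (h i j))"
      unfolding sum_subtractf[symmetric] using lin[OF i]
      by (intro sum.cong) (auto simp: a_def linear_CD scaleR_conv_of_real[where 'a = complex])
    then show ?thesis using I i by (simp add: sum.delta')
  qed
  ultimately show ?thesis by (simp add: sum_subtractf sum_distrib_left K_def)
qed

text \<open>Rotating by a phase \<open>c\<close> makes the value a nonnegative real. Then only the
  self-adjoint part of the rotated matrix contributes, so splitting costs no factor 2.\<close>

lemma pos_functional_bound: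
  fixes x :: "'i \<Rightarrow> 'i \<Rightarrow> 'a::unital_cstar_algebra"
  assumes I: "finite I" and m: "pos_functional I m" and T: "(\<Sum>i\<in>I. m i i 1) = 1"
    and x: "\<And>i j. i \<in> I \<Longrightarrow> j \<in> I \<Longrightarrow> norm (x i j) \<le> M"
  shows "cmod (\<Sum>i\<in>I. \<Sum>j\<in>I. m i j (x i j)) \<le> real (card I) * M"
proof -
  define S where "S = (\<Sum>i\<in>I. \<Sum>j\<in>I. m i j (x i j))"
  obtain c where c: "cmod c = 1" "c * S = of_real (cmod S)"
  proof (cases "S = 0")
    case False
    then show ?thesis
      by (intro that[of "of_real (cmod S) / S"]) (auto simp: norm_divide)
  qed (use that[of 1] in auto)
  have lin: "linear_C (m i j)" if "i \<in> I" "j \<in> I" for i j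
    using m that by (simp add: pos_functional_def)
  define h where "h i j = (1 / 2) *\<^sub>R (c *\<^sub>C x i j + adj (c *\<^sub>C x j i))" for i j
  define g where "g i j = (\<i> / 2) *\<^sub>C (adj (c *\<^sub>C x j i) - c *\<^sub>C x i j)" for i j
  have decomp: "c *\<^sub>C x i j = h i j + \<i> *\<^sub>C g i j" for i j
  proof -
    have "\<i> *\<^sub>C g i j = (1 / 2) *\<^sub>R (c *\<^sub>C x i j - adj (c *\<^sub>C x j i))"
      by (simp add: g_def scaleC_scaleC scaleR_eq_scaleC scaleC_diff_right)
        (metis (no_types) minus_diff_eq mult_minus1 scaleC_diff_right scaleC_minus_one
          scaleC_scaleC)
    then show ?thesis by (simp add: h_def flip: scaleR_add_right scaleR_2)
  qed
  have nx: "norm (c *\<^sub>C x i j) \<le> M" "norm (adj (c *\<^sub>C x i j)) \<le> M" if "i \<in> I" "j \<in> I" for i j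
    using x[OF that] c(1) by (simp_all add: norm_scaleC)
  have h: "adj (h i j) = h j i" for i j by (simp add: h_def adj_simps add.commute)
  have nh: "norm (h i j) \<le> M" if "i \<in> I" "j \<in> I" for i j
    using norm_triangle_ineq[of "c *\<^sub>C x i j" "adj (c *\<^sub>C x j i)"] nx(1)[OF that] nx(2)[of j i] that
    by (simp add: h_def)
  have g: "adj (g i j) = g j i" for i j
    by (simp add: g_def adj_simps scaleC_minus_left flip: scaleC_minus_right)
  have ng: "norm (g i j) \<le> M" if "i \<in> I" "j \<in> I" for i j
    using norm_triangle_ineq4[of "adj (c *\<^sub>C x j i)" "c *\<^sub>C x i j"] nx(1)[OF that] nx(2)[of j i] that
    by (simp add: g_def norm_scaleC[of "\<i> / 2"] norm_divide)
  define H where "H = (\<Sum>i\<in>I. \<Sum>j\<in>I. m i j (h i j))"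
  define G where "G = (\<Sum>i\<in>I. \<Sum>j\<in>I. m i j (g i j))"
  have "c * S = H + \<i> * G"
  proof -
    have "c * m i j (x i j) = m i j (h i j) + \<i> * m i j (g i j)" if "i \<in> I" "j \<in> I" for i j
      using linear_C_scaleC[OF lin[OF that], of c "x i j"] lin[OF that]
      by (simp add: decomp linear_CD scaleC_complex_def)
    then show ?thesis by (simp add: S_def H_def G_def sum_distrib_left sum.distrib cong: sum.cong)
  qed
  then have "cmod S = Re H - Im G" using c(2) by (metis Re_complex_of_real Re_i_times plus_complex.simps(1) uminus_add_conv_diff add.commute)
  \<comment> \<open>The bound for \<open>g\<close> enters only through the realness of
    \<open>G\<close>.\<close>
  moreover have "Im G = 0" "Re H \<le> real (card I) * M"
    using pos_functional_selfadj_bound[OF I m g ng] pos_functional_selfadj_bound[OF I m h nh] T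
    by (simp_all add: complex_nonneg_Reals_iff H_def G_def)
  ultimately show ?thesis by (simp add: S_def)
qed

section \<open>States on matrix algebras\<close>

lemma elems_mat_alg [simp]: "elems (mat_alg q) = carrier_mat q q"
  and ident_mat_alg [simp]: "ident (mat_alg q) = 1\<^sub>m q"
  and alg_norm_mat_alg [simp]: "alg_norm (mat_alg q) = mat_norm"
  by (simp_all add: mat_alg_def)

lemma dim_scaleC_mat [simp]: "dim_row (c *\<^sub>C X) = dim_row X" "dim_col (c *\<^sub>C X) = dim_col X"
  for X :: "'a::unital_cstar_algebra mat"
  by (simp_all add: scaleC_mat_def)

lemma dim_adj_mat [simp]: "dim_row (adj X) = dim_col X" "dim_col (adj X) = dim_row X"
  for X :: "'a::unital_cstar_algebra mat"
  by (simp_all add: adj_mat_def)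

lemma scaleC_carrier_mat [simp]: "X \<in> carrier_mat n k \<Longrightarrow> c *\<^sub>C X \<in> carrier_mat n k"
  for X :: "'a::unital_cstar_algebra mat"
  unfolding carrier_mat_def by simp

lemma adj_carrier_mat [simp]: "X \<in> carrier_mat n k \<Longrightarrow> adj X \<in> carrier_mat k n"
  for X :: "'a::unital_cstar_algebra mat"
  unfolding carrier_mat_def by simp

lemma index_scaleC_mat [simp]:
  "i < dim_row X \<Longrightarrow> j < dim_col X \<Longrightarrow> (c *\<^sub>C X) $$ (i, j) = c *\<^sub>C X $$ (i, j)"
  for X :: "'a::unital_cstar_algebra mat"
  by (simp add: scaleC_mat_def)

lemma index_adj_mat [simp]:
  "i < dim_col X \<Longrightarrow> j < dim_row X \<Longrightarrow> adj X $$ (i, j) = adj (X $$ (j, i))"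
  for X :: "'a::unital_cstar_algebra mat"
  by (simp add: adj_mat_def)

lemma index_times_mat:
  "X \<in> carrier_mat n k \<Longrightarrow> Y \<in> carrier_mat k l \<Longrightarrow> i < n \<Longrightarrow> j < l \<Longrightarrow>
    (X * Y) $$ (i, j) = (\<Sum>r<k. X $$ (i, r) * Y $$ (r, j))"
  for X :: "'a::unital_cstar_algebra mat"
  by (auto simp: scalar_prod_def lessThan_atLeast0 intro!: sum.cong)

lemma states_entries:
  fixes \<mu> :: "'a::unital_cstar_algebra mat \<Rightarrow> complex"
  assumes \<mu>: "\<mu> \<in> states (mat_alg q)" and q: "q \<ge> 1"
  obtains m where "pos_functional {..<q} m" "(\<Sum>i<q. m i i 1) = 1"
    "\<And>X. X \<in> carrier_mat q q \<Longrightarrow> \<mu> X = (\<Sum>i<q. \<Sum>j<q. m i j (X $$ (i, j)))"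
proof -
  define U where "U i j a = mat q q (\<lambda>(k, l). if k = i \<and> l = j then a else (0::'a))" for i j a
  define m where "m i j a = \<mu> (U i j a)" for i j a
  have U [simp]: "U i j a \<in> carrier_mat q q" for i j a by (simp add: U_def)
  have add: "\<mu> (X + Y) = \<mu> X + \<mu> Y" if "X \<in> carrier_mat q q" "Y \<in> carrier_mat q q" for X Y
    using \<mu> that by (simp add: states_def)
  have scale: "\<mu> (c *\<^sub>C X) = c * \<mu> X" if "X \<in> carrier_mat q q" for c X
    using \<mu> that by (simp add: states_def)
  have zero: "\<mu> (0\<^sub>m q q) = 0"
  proof -
    have "0 *\<^sub>C 0\<^sub>m q q = (0\<^sub>m q q :: 'a mat)" by (rule eq_matI) auto
    then show ?thesis using scale[of "0\<^sub>m q q" 0] by simp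
  qed
  have lin: "linear_C (m i j)" for i j
    unfolding linear_C_def
  proof (intro conjI allI)
    show "m i j (x + y) = m i j x + m i j y" for x y
    proof -
      have "U i j (x + y) = U i j x + U i j y" by (rule eq_matI) (auto simp: U_def)
      then show ?thesis by (simp add: m_def add)
    qed
    show "m i j (c *\<^sub>C x) = c *\<^sub>C m i j x" for c x
    proof -
      have "U i j (c *\<^sub>C x) = c *\<^sub>C U i j x" by (rule eq_matI) (auto simp: U_def)
      then show ?thesis by (simp add: m_def scale scaleC_complex_def)
    qed
  qed
  have expand: "\<mu> X = (\<Sum>i<q. \<Sum>j<q. m i j (X $$ (i, j)))" if X: "X \<in> carrier_mat q q" for X
  proof -
    \<comment> \<open>\<open>R S\<close> keeps the entries of \<open>X\<close> at positions in
      \<open>S\<close>, so that the expansion follows by induction on \<open>S\<close>.\<close>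
    define R where "R S = mat q q (\<lambda>p. if p \<in> S then X $$ p else 0)" for S
    have "\<mu> (R S) = (\<Sum>p\<in>S. m (fst p) (snd p) (X $$ p))"
      if "finite S" "S \<subseteq> {..<q} \<times> {..<q}" for S
      using that
    proof (induction S rule: finite_induct)
      case empty
      have "R {} = 0\<^sub>m q q" by (rule eq_matI) (auto simp: R_def)
      then show ?case by (simp add: zero)
    next
      case (insert p S)
      have "R (insert p S) = U (fst p) (snd p) (X $$ p) + R S"
        using insert.hyps by (intro eq_matI) (auto simp: R_def U_def)
      then show ?case using insert by (simp add: add R_def m_def)
    qed
    from this[of "{..<q} \<times> {..<q}"] have "\<mu> (R ({..<q} \<times> {..<q})) =
        (\<Sum>p\<in>{..<q} \<times> {..<q}. m (fst p) (snd p) (X $$ p))" by simp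
    moreover have "R ({..<q} \<times> {..<q}) = X" using X by (intro eq_matI) (auto simp: R_def)
    ultimately show ?thesis by (simp add: sum.cartesian_product case_prod_unfold)
  qed
  have pos: "pos_functional {..<q} m"
    unfolding pos_functional_def
  proof (intro conjI ballI allI lin)
    fix z :: "nat \<Rightarrow> 'a"
    \<comment> \<open>The row \<open>z\<close> on top of zeros, so that \<open>adj Z * Z\<close> has
      the entries \<open>adj (z i) * z j\<close>. Row 0 exists because
      \<open>q \<ge> 1\<close>.\<close>
    define Z where "Z = mat q q (\<lambda>(k, i). if k = 0 then z i else 0)"
    have Z: "Z \<in> carrier_mat q q" by (simp add: Z_def)
    have "(adj Z * Z) $$ (i, j) = adj (z i) * z j" if "i < q" "j < q" for i j
    proof -
      have "(adj Z * Z) $$ (i, j) = (\<Sum>k<q. adj (Z $$ (k, i)) * Z $$ (k, j))"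
        using Z that by (subst index_times_mat[where k = q]) auto
      also have "\<dots> = (\<Sum>k<q. if k = 0 then adj (z i) * z j else 0)"
        using that by (intro sum.cong) (auto simp: Z_def)
      finally show ?thesis using q by simp
    qed
    then have "\<mu> (adj Z * Z) = (\<Sum>i<q. \<Sum>j<q. m i j (adj (z i) * z j))"
      using Z by (subst expand) (auto intro!: sum.cong)
    moreover have "\<mu> (adj Z * Z) \<in> \<real>\<^sub>\<ge>\<^sub>0"
      using \<mu> Z by (simp add: states_def complex_nonneg_Reals_iff)
    ultimately show "(\<Sum>i<q. \<Sum>j<q. m i j (adj (z i) * z j)) \<in> \<real>\<^sub>\<ge>\<^sub>0" by simp
  qed
  have "(\<Sum>i<q. m i i 1) = 1"
  proof -
    have "(\<Sum>j<q. m i j (1\<^sub>m q $$ (i, j))) = m i i 1" if i: "i < q" for i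
    proof -
      have "(\<Sum>j<q. m i j (1\<^sub>m q $$ (i, j))) = (\<Sum>j<q. if j = i then m i i 1 else 0)"
        using i linear_C_zero[OF lin] by (intro sum.cong) auto
      then show ?thesis using i by simp
    qed
    then have "(\<Sum>i<q. m i i 1) = (\<Sum>i<q. \<Sum>j<q. m i j (1\<^sub>m q $$ (i, j)))" by simp
    also have "\<dots> = \<mu> (1\<^sub>m q)" by (subst expand) auto
    finally show ?thesis using \<mu> by (simp add: states_def)
  qed
  then show ?thesis using that[OF pos _ expand] by blast
qed

text \<open>Converse of \<open>states_entries\<close>: \<open>adj X * X\<close> is the sum, over the
  rows of \<open>X\<close>, of the matrices at which \<open>pos_functional\<close> demands
  nonnegativity.\<close>

lemma pos_functional_state:
  fixes m :: "nat \<Rightarrow> nat \<Rightarrow> 'a::unital_cstar_algebra \<Rightarrow> complex"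
  assumes m: "pos_functional {..<q} m" and one: "(\<Sum>i<q. m i i 1) = 1"
  shows "restrict (\<lambda>X. \<Sum>i<q. \<Sum>j<q. m i j (X $$ (i, j))) (carrier_mat q q) \<in> states (mat_alg q)"
proof -
  define f where "f X = (\<Sum>i<q. \<Sum>j<q. m i j (X $$ (i, j)))" for X
  have lin: "linear_C (m i j)" if "i < q" "j < q" for i j
    using m that by (simp add: pos_functional_def)
  have add: "f (X + Y) = f X + f Y" if "X \<in> carrier_mat q q" "Y \<in> carrier_mat q q" for X Y
    unfolding f_def using that lin
    by (simp add: linear_CD flip: sum.distrib)
  have scale: "f (c *\<^sub>C X) = c * f X" if "X \<in> carrier_mat q q" for c X
    unfolding f_def using that lin
    by (simp add: linear_CD scaleC_complex_def sum_distrib_left)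
  have pos: "f (adj X * X) \<in> \<real>\<^sub>\<ge>\<^sub>0" if X: "X \<in> carrier_mat q q" for X
  proof -
    have e: "(adj X * X) $$ (i, j) = (\<Sum>k<q. adj (X $$ (k, i)) * X $$ (k, j))" if "i < q" "j < q" for i j
      using X that by (subst index_times_mat[where k = q]) (auto intro!: sum.cong)
    have "f (adj X * X) = (\<Sum>i<q. \<Sum>j<q. \<Sum>k<q. m i j (adj (X $$ (k, i)) * X $$ (k, j)))"
      unfolding f_def by (intro sum.cong refl) (simp add: e linear_C_sum[OF lin])
    also have "\<dots> = (\<Sum>i<q. \<Sum>k<q. \<Sum>j<q. m i j (adj (X $$ (k, i)) * X $$ (k, j)))"
      by (rule sum.cong[OF refl]) (rule sum.swap)
    also have "\<dots> = (\<Sum>k<q. \<Sum>i<q. \<Sum>j<q. m i j (adj (X $$ (k, i)) * X $$ (k, j)))" by (rule sum.swap)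
    also have "\<dots> \<in> \<real>\<^sub>\<ge>\<^sub>0"
      by (rule nonneg_Reals_sum) (use m in \<open>simp add: pos_functional_def\<close>)
    finally show ?thesis .
  qed
  have "f (1\<^sub>m q) = 1"
  proof -
    have "(\<Sum>j<q. m i j (1\<^sub>m q $$ (i, j))) = m i i 1" if i: "i < q" for i
    proof -
      have "(\<Sum>j<q. m i j (1\<^sub>m q $$ (i, j))) = (\<Sum>j<q. if j = i then m i i 1 else 0)"
        using i linear_C_zero[OF lin] by (intro sum.cong) auto
      then show ?thesis using i by simp
    qed
    then show ?thesis by (simp add: f_def one)
  qed
  then show ?thesis
    using pos unfolding f_def[symmetric]
    by (auto simp: states_def add scale complex_nonneg_Reals_iff)
qed

lemma state_bound:
  fixes X :: "'a::unital_cstar_algebra mat"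
  assumes \<mu>: "\<mu> \<in> states (mat_alg q)" and q: "q \<ge> 1" and X: "X \<in> carrier_mat q q"
    and M: "\<And>i j. i < q \<Longrightarrow> j < q \<Longrightarrow> norm (X $$ (i, j)) \<le> M"
  shows "cmod (\<mu> X) \<le> q * M"
proof -
  obtain m where "pos_functional {..<q} m" "(\<Sum>i<q. m i i 1) = 1"
    "\<And>X. X \<in> carrier_mat q q \<Longrightarrow> \<mu> X = (\<Sum>i<q. \<Sum>j<q. m i j (X $$ (i, j)))"
    by (rule states_entries[OF \<mu> q]) blast
  then show ?thesis using pos_functional_bound[of "{..<q}" m "\<lambda>i j. X $$ (i, j)" M] M X by simp
qed

text \<open>For a linear map \<open>f\<close>, the last condition is complete positivity.\<close>

definition cp_map :: "('d::unital_cstar_algebra \<Rightarrow> 'a::unital_cstar_algebra) \<Rightarrow> bool" where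
  "cp_map f \<longleftrightarrow> linear_C f \<and> (\<forall>x. f (adj x) = adj (f x))
     \<and> (\<forall>(I::nat set) x b. pos (\<Sum>i\<in>I. \<Sum>j\<in>I. adj (b i) * f (adj (x i) * x j) * b j))"

text \<open>Complete positivity says that the matrix with entries \<open>f (adj (z i) * z j)\<close>
  has positive form, which is what \<open>pos_functional_nonneg\<close> asks for.\<close>

lemma cp_map_pos_functional:
  assumes "cp_map f" "finite I" "pos_functional (I::nat set) m"
  shows "pos_functional I (\<lambda>i j x. m i j (f x))"
  unfolding pos_functional_def
proof (intro conjI ballI allI)
  show "linear_C (\<lambda>x. m i j (f x))" if "i \<in> I" "j \<in> I" for i j
    using assms that by (simp add: linear_C_def cp_map_def pos_functional_def)
  show "(\<Sum>i\<in>I. \<Sum>j\<in>I. m i j (f (adj (z i) * z j))) \<in> \<real>\<^sub>\<ge>\<^sub>0" for z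
  proof (rule pos_functional_nonneg[OF assms(2,3)])
    show "adj (f (adj (z i) * z j)) = f (adj (z j) * z i)" for i j
      using assms(1) unfolding cp_map_def by (metis adj_adj adj_mult)
    show "pos (\<Sum>i\<in>I. \<Sum>j\<in>I. adj (b i) * f (adj (z i) * z j) * b j)" for b
      using assms(1) by (simp add: cp_map_def)
  qed
qed

text \<open>Composition is immediate for this property, which is how
  \<open>\<Phi>\<^sup>A \<circ> \<Phi>\<^sup>B\<close> is handled.\<close>

definition pulls_back_states ::
  "nat \<Rightarrow> ('d::unital_cstar_algebra \<Rightarrow> 'a::unital_cstar_algebra) \<Rightarrow> bool" where
  "pulls_back_states q f \<longleftrightarrow>
     (\<forall>\<mu>\<in>states (mat_alg q). restrict (\<lambda>X. \<mu> (map_mat f X)) (carrier_mat q q) \<in> states (mat_alg q))"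

lemma cp_map_pulls_back_states:
  fixes f :: "'d::unital_cstar_algebra \<Rightarrow> 'a::unital_cstar_algebra"
  assumes f: "cp_map f" "f 1 = 1" and q: "q \<ge> 1"
  shows "pulls_back_states q f"
  unfolding pulls_back_states_def
proof
  fix \<mu> :: "'a mat \<Rightarrow> complex" assume \<mu>: "\<mu> \<in> states (mat_alg q)"
  obtain m where m: "pos_functional {..<q} m" "(\<Sum>i<q. m i i 1) = 1"
    "\<And>X. X \<in> carrier_mat q q \<Longrightarrow> \<mu> X = (\<Sum>i<q. \<Sum>j<q. m i j (X $$ (i, j)))"
    by (rule states_entries[OF \<mu> q]) blast
  have "restrict (\<lambda>X. \<mu> (map_mat f X)) (carrier_mat q q) =
      restrict (\<lambda>X. \<Sum>i<q. \<Sum>j<q. m i j (f (X $$ (i, j)))) (carrier_mat q q)"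
    by (rule restrict_ext) (auto simp: m(3) intro!: sum.cong)
  also have "\<dots> \<in> states (mat_alg q)"
    by (rule pos_functional_state) (use m f cp_map_pos_functional[OF f(1) _ m(1)] in auto)
  finally show "restrict (\<lambda>X. \<mu> (map_mat f X)) (carrier_mat q q) \<in> states (mat_alg q)" .
qed

lemma pulls_back_states_comp:
  fixes f :: "'d::unital_cstar_algebra \<Rightarrow> 'a::unital_cstar_algebra"
    and g :: "'c::unital_cstar_algebra \<Rightarrow> 'd"
  assumes "pulls_back_states q f" "pulls_back_states q g"
  shows "pulls_back_states q (\<lambda>x. f (g x))"
  unfolding pulls_back_states_def
proof
  fix \<mu> :: "'a mat \<Rightarrow> complex" assume "\<mu> \<in> states (mat_alg q)"
  with assms have "restrict (\<lambda>X. restrict (\<lambda>X. \<mu> (map_mat f X)) (carrier_mat q q) (map_mat g X))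
      (carrier_mat q q) \<in> states (mat_alg q)" unfolding pulls_back_states_def by blast
  also have "restrict (\<lambda>X. restrict (\<lambda>X. \<mu> (map_mat f X)) (carrier_mat q q) (map_mat g X))
      (carrier_mat q q) = restrict (\<lambda>X. \<mu> (map_mat (\<lambda>x. f (g x)) X)) (carrier_mat q q)"
  proof (rule restrict_ext)
    fix X :: "'c mat" assume "X \<in> carrier_mat q q"
    moreover have "map_mat f (map_mat g X) = map_mat (\<lambda>x. f (g x)) X" by (rule eq_matI) auto
    ultimately show "restrict (\<lambda>X. \<mu> (map_mat f X)) (carrier_mat q q) (map_mat g X) =
        \<mu> (map_mat (\<lambda>x. f (g x)) X)" by simp
  qed
  finally show "restrict (\<lambda>X. \<mu> (map_mat (\<lambda>x. f (g x)) X)) (carrier_mat q q) \<in> states (mat_alg q)" .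
qed

lemma unital_star_hom_cp_map:
  assumes "unital_star_hom f" shows "cp_map f"
  unfolding cp_map_def
proof (intro conjI allI)
  show "linear_C f" "f (adj x) = adj (f x)" for x using assms by (auto simp: unital_star_hom_def)
  fix I :: "nat set" and x b
  have "(\<Sum>i\<in>I. \<Sum>j\<in>I. adj (b i) * f (adj (x i) * x j) * b j) =
      adj (\<Sum>j\<in>I. f (x j) * b j) * (\<Sum>j\<in>I. f (x j) * b j)"
    using assms by (simp add: unital_star_hom_def adj_sum sum_product adj_mult mult.assoc)
  then show "pos (\<Sum>i\<in>I. \<Sum>j\<in>I. adj (b i) * f (adj (x i) * x j) * b j)"
    by (simp only: pos_adj_mult)
qed

section \<open>The norm on matrices and the first level of a matrix slip-norm\<close>

lemma norm_index_le_col_norm: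
  fixes v :: "'a::unital_cstar_algebra vec"
  assumes "i < dim_vec v" shows "norm (v $ i) \<le> col_norm v"
proof -
  have "(\<Sum>k<dim_vec v. adj (v $ k) * v $ k) - adj (v $ i) * v $ i =
      (\<Sum>k\<in>{..<dim_vec v} - {i}. adj (v $ k) * v $ k)"
    using assms by (simp add: sum_diff1)
  then have "norm (adj (v $ i) * v $ i) \<le> norm (\<Sum>k<dim_vec v. adj (v $ k) * v $ k)"
    by (intro pos_norm_mono pos_adj_mult) (simp add: pos_sum pos_adj_mult)
  then have "(norm (v $ i))\<^sup>2 \<le> norm (\<Sum>k<dim_vec v. adj (v $ k) * v $ k)"
    by (simp add: cstar_identity)
  then show ?thesis unfolding col_norm_def by (rule real_le_rsqrt)
qed

lemma col_norm_zero: "col_norm (0\<^sub>v n :: 'a::unital_cstar_algebra vec) = 0"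
  by (simp add: col_norm_def)

lemma mat_norm_leI:
  fixes X :: "'a::unital_cstar_algebra mat"
  assumes "\<And>v. v \<in> carrier_vec (dim_col X) \<Longrightarrow> col_norm v \<le> 1 \<Longrightarrow> col_norm (X *\<^sub>v v) \<le> M"
  shows "mat_norm X \<le> M"
  unfolding mat_norm_def
proof (rule cSup_least)
  have "0\<^sub>v (dim_col X) \<in> carrier_vec (dim_col X)" "col_norm (0\<^sub>v (dim_col X) :: 'a vec) \<le> 1"
    by (simp_all add: col_norm_zero)
  then show "{col_norm (X *\<^sub>v v) |v. v \<in> carrier_vec (dim_col X) \<and> col_norm v \<le> 1} \<noteq> {}" by blast
qed (use assms in blast)

lemma index_mult_mat_vec_sum:
  "X \<in> carrier_mat n k \<Longrightarrow> v \<in> carrier_vec k \<Longrightarrow> i < n \<Longrightarrow>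
    (X *\<^sub>v v) $ i = (\<Sum>j<k. X $$ (i, j) * v $ j)"
  for X :: "'a::unital_cstar_algebra mat"
  by (auto simp: scalar_prod_def lessThan_atLeast0 intro!: sum.cong)

text \<open>In the order of the algebra, \<open>adj (u i j) * u i j\<close> is at most
  \<open>M\<^sup>2\<close> times \<open>adj (v $ j) * v $ j\<close>. One factor \<open>q\<close>
  then comes from Cauchy-Schwarz in each row and another from the number of rows.\<close>

lemma mat_norm_le_entries:
  fixes X :: "'a::unital_cstar_algebra mat"
  assumes X: "X \<in> carrier_mat q q" and M: "\<And>i j. i < q \<Longrightarrow> j < q \<Longrightarrow> norm (X $$ (i, j)) \<le> M"
    and "M \<ge> 0"
  shows "mat_norm X \<le> q * M"
proof (rule mat_norm_leI)
  fix v :: "'a vec" assume "v \<in> carrier_vec (dim_col X)" and cv: "col_norm v \<le> 1"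
  then have v: "v \<in> carrier_vec q" using X by simp
  define u where "u i j = X $$ (i, j) * v $ j" for i j
  define w where "w i = (\<Sum>j<q. u i j)" for i
  define N where "N = (\<Sum>j<q. adj (v $ j) * v $ j)"
  have w: "(X *\<^sub>v v) $ i = w i" if "i < q" for i
    using index_mult_mat_vec_sum[OF X v that] by (simp add: w_def u_def)
  have "pos (\<Sum>i<q. (real q *\<^sub>R (\<Sum>j<q. M\<^sup>2 *\<^sub>R (adj (v $ j) * v $ j) - adj (u i j) * u i j)) +
      (real q *\<^sub>R (\<Sum>j<q. adj (u i j) * u i j) - adj (w i) * w i))"
  proof (intro pos_sum pos_add)
    fix i assume "i \<in> {..<q}"
    then show "pos (real q *\<^sub>R (\<Sum>j<q. M\<^sup>2 *\<^sub>R (adj (v $ j) * v $ j) - adj (u i j) * u i j))"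
      unfolding u_def by (intro pos_scaleR pos_sum pos_scaleR_adj_mult_diff M) auto
    show "pos (real q *\<^sub>R (\<Sum>j<q. adj (u i j) * u i j) - adj (w i) * w i)"
      using pos_sum_square_diff[of "{..<q}" "u i"] by (simp add: w_def)
  qed
  also have "(\<Sum>i<q. (real q *\<^sub>R (\<Sum>j<q. M\<^sup>2 *\<^sub>R (adj (v $ j) * v $ j) - adj (u i j) * u i j)) +
      (real q *\<^sub>R (\<Sum>j<q. adj (u i j) * u i j) - adj (w i) * w i)) =
      (q * M)\<^sup>2 *\<^sub>R N - (\<Sum>i<q. adj (w i) * w i)"
    by (simp add: sum_subtractf scaleR_diff_right N_def sum_constant_scaleR power2_eq_square ac_simps
        del: sum_constant flip: scaleR_sum_right)
  finally have "norm (\<Sum>i<q. adj (w i) * w i) \<le> norm ((q * M)\<^sup>2 *\<^sub>R N)"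
    by (intro pos_norm_mono pos_sum pos_adj_mult)
  also have "\<dots> \<le> (q * M)\<^sup>2 * 1"
    using cv v by (simp add: mult_left_le col_norm_def N_def)
  finally have "norm (\<Sum>i<q. adj (w i) * w i) \<le> (q * M)\<^sup>2" by simp
  then have "sqrt (norm (\<Sum>i<q. adj (w i) * w i)) \<le> q * M"
    using \<open>M \<ge> 0\<close> by (intro real_le_lsqrt) auto
  moreover have "(\<Sum>i<q. adj ((X *\<^sub>v v) $ i) * (X *\<^sub>v v) $ i) = (\<Sum>i<q. adj (w i) * w i)"
    by (intro sum.cong) (auto simp: w)
  then have "col_norm (X *\<^sub>v v) = sqrt (norm (\<Sum>i<q. adj (w i) * w i))"
    using X by (simp add: col_norm_def)
  ultimately show "col_norm (X *\<^sub>v v) \<le> q * M" by simp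
qed

text \<open>The entry is the 1 by 1 matrix \<open>\<alpha> * X * \<beta>\<close> for a basis row
  \<open>\<alpha>\<close> and a basis column \<open>\<beta>\<close>, both of norm at most 1.\<close>

lemma level_one_index_le:
  fixes X :: "'a::unital_cstar_algebra mat"
  assumes L: "matrix_slip_norm L" and X: "X \<in> carrier_mat q q" and ij: "i < q" "j < q"
  shows "level_one L (X $$ (i, j)) \<le> L q X"
proof -
  define \<alpha> where "\<alpha> = mat 1 q (\<lambda>(_, k). if k = i then 1 else (0::complex))"
  define \<beta> where "\<beta> = mat q 1 (\<lambda>(k, _). if k = j then 1 else (0::complex))"
  have z: "(0::nat) < 1" by simp
  have carr: "\<alpha> \<in> carrier_mat 1 q" "\<beta> \<in> carrier_mat q 1" by (simp_all add: \<alpha>_def \<beta>_def)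
  have "mat_norm \<alpha> \<le> 1"
  proof (rule mat_norm_leI)
    fix v :: "complex vec" assume v: "v \<in> carrier_vec (dim_col \<alpha>)" "col_norm v \<le> 1"
    have v': "v \<in> carrier_vec q" using v by (simp add: \<alpha>_def)
    have "(\<alpha> *\<^sub>v v) $ 0 = (\<Sum>k<q. if k = i then v $ k else 0)"
      unfolding index_mult_mat_vec_sum[OF carr(1) v' z]
      by (intro sum.cong) (auto simp: \<alpha>_def)
    then have "(\<alpha> *\<^sub>v v) $ 0 = v $ i" using ij by simp
    then have "col_norm (\<alpha> *\<^sub>v v) = norm (v $ i)"
      by (simp add: col_norm_def cstar_identity \<alpha>_def)
    then show "col_norm (\<alpha> *\<^sub>v v) \<le> 1"
      using norm_index_le_col_norm[of i v] v(2) v' ij by simp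
  qed
  moreover have "mat_norm \<beta> \<le> 1"
  proof (rule mat_norm_leI)
    fix v :: "complex vec" assume v: "v \<in> carrier_vec (dim_col \<beta>)" "col_norm v \<le> 1"
    have v': "v \<in> carrier_vec 1" using v by (simp add: \<beta>_def)
    have "(\<beta> *\<^sub>v v) $ k = (if k = j then v $ 0 else 0)" if "k < q" for k
      using index_mult_mat_vec_sum[OF carr(2) v' that] that by (simp add: \<beta>_def)
    then have "(\<Sum>k<q. adj ((\<beta> *\<^sub>v v) $ k) * (\<beta> *\<^sub>v v) $ k) =
        (\<Sum>k<q. if k = j then adj (v $ 0) * v $ 0 else 0)"
      by (intro sum.cong) auto
    then have "col_norm (\<beta> *\<^sub>v v) = norm (v $ 0)"
      using ij by (simp add: col_norm_def cstar_identity \<beta>_def)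
    then show "col_norm (\<beta> *\<^sub>v v) \<le> 1"
      using norm_index_le_col_norm[of 0 v] v(2) v' by simp
  qed
  moreover have "L 1 (of_scalar_mat \<alpha> * X * of_scalar_mat \<beta>) \<le>
      ennreal (mat_norm \<alpha>) * L q X * ennreal (mat_norm \<beta>)"
    using L X carr ij unfolding matrix_slip_norm_def by simp
  moreover have "ennreal (mat_norm \<alpha>) * L q X * ennreal (mat_norm \<beta>) \<le> 1 * L q X * 1"
    using calculation(1,2) by (intro mult_mono) (auto simp: ennreal_le_1)
  moreover have "of_scalar_mat \<alpha> * X * of_scalar_mat \<beta> = mat 1 1 (\<lambda>_. X $$ (i, j))"
  proof (rule eq_matI)
    fix k l assume "k < dim_row (mat 1 1 (\<lambda>_. X $$ (i, j)))" "l < dim_col (mat 1 1 (\<lambda>_. X $$ (i, j)))"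
    then have kl: "k = 0" "l = 0" by auto
    have c: "of_scalar_mat \<alpha> \<in> carrier_mat 1 q" "of_scalar_mat \<beta> \<in> carrier_mat q 1"
      "of_scalar_mat \<alpha> * X \<in> carrier_mat 1 q"
      using carr X by (auto simp: of_scalar_mat_def)
    have aX: "(of_scalar_mat \<alpha> * X) $$ (0, s) = X $$ (i, s)" if "s < q" for s
    proof -
      have "(of_scalar_mat \<alpha> * X) $$ (0, s) = (\<Sum>r<q. if r = i then X $$ (r, s) else 0)"
        unfolding index_times_mat[OF c(1) X z that]
        by (intro sum.cong) (auto simp: of_scalar_mat_def \<alpha>_def)
      then show ?thesis using ij by simp
    qed
    have "(of_scalar_mat \<alpha> * X * of_scalar_mat \<beta>) $$ (0, 0) = (\<Sum>s<q. if s = j then X $$ (i, s) else 0)"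
      unfolding index_times_mat[OF c(3) c(2) z z]
      by (intro sum.cong) (auto simp: aX, auto simp: of_scalar_mat_def \<beta>_def)
    then show "(of_scalar_mat \<alpha> * X * of_scalar_mat \<beta>) $$ (k, l) = mat 1 1 (\<lambda>_. X $$ (i, j)) $$ (k, l)"
      using ij by (simp add: kl)
  qed (use carr X in \<open>auto simp: of_scalar_mat_def\<close>)
  ultimately show ?thesis unfolding level_one_def by (metis mult_1 mult_1_right order_trans)
qed

text \<open>The constants in the bounds are suprema over self-adjoint elements, whereas off-diagonal
  entries of a self-adjoint matrix need not be self-adjoint. Both parts \<open>h\<close> and
  \<open>g\<close> of \<open>a\<close> stay in the slip-norm ball.\<close>

lemma linear_bound_of_slip_ball:
  fixes L :: "nat \<Rightarrow> 'a::unital_cstar_algebra mat \<Rightarrow> ennreal"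
    and f :: "'a \<Rightarrow> 'b::unital_cstar_algebra"
  assumes L: "matrix_slip_norm L" and f: "linear_C f"
    and c: "\<And>h. h \<in> slip_ball type_alg (level_one L) \<Longrightarrow> ennreal (norm (f h)) \<le> c"
    and a: "level_one L a \<le> 1"
  shows "ennreal (norm (f a)) \<le> 2 * c"
proof -
  define h where "h = (1 / 2) *\<^sub>C (a + adj a)"
  define g where "g = (\<i> / 2) *\<^sub>C (adj a - a)"
  have sl: "level_one L (x + y) \<le> level_one L x + level_one L y"
    "level_one L (k *\<^sub>C x) = ennreal (cmod k) * level_one L x"
    "level_one L (adj x) = level_one L x" for x y k
    using L by (auto simp: matrix_slip_norm_def slip_norm_def seminorm_on_def type_alg_def)
  have half: "ennreal (cmod k) * level_one L (x + y) \<le> 1"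
    if "cmod k = 1 / 2" "level_one L x \<le> 1" "level_one L y \<le> 1" for k x y
  proof -
    have "level_one L (x + y) \<le> 1 + 1"
      using sl(1)[of x y] add_mono[OF that(2,3)] by (rule order_trans)
    then have "ennreal (cmod k) * level_one L (x + y) \<le> ennreal (1 / 2) * ennreal 2"
      unfolding that(1) by (intro mult_left_mono) simp_all
    also have "\<dots> = 1" by (subst ennreal_mult[symmetric]) auto
    finally show ?thesis .
  qed
  have "level_one L (- a) \<le> 1" using sl(2)[of "-1" a] a by (simp add: scaleC_minus_one)
  then have "level_one L h \<le> 1" "level_one L g \<le> 1"
    using half[of "1 / 2" a "adj a"] half[of "\<i> / 2" "adj a" "- a"] a
    by (simp_all add: h_def g_def sl(2,3) norm_divide)
  moreover have "adj h = h" by (simp add: h_def adj_simps add.commute)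
  moreover have "adj g = g" by (simp add: g_def adj_simps scaleC_minus_left flip: scaleC_minus_right)
  ultimately have "ennreal (norm (f h)) \<le> c" "ennreal (norm (f g)) \<le> c"
    by (auto intro!: c simp: slip_ball_def type_alg_def)
  moreover have "a = h + \<i> *\<^sub>C g"
  proof -
    have "\<i> *\<^sub>C g = (1 / 2) *\<^sub>C (a - adj a)"
      by (simp add: g_def scaleC_scaleC scaleC_minus_left flip: scaleC_minus_right)
    then show ?thesis
      by (simp add: h_def scaleC_add_right[symmetric] scaleC_scaleC flip: scaleC_of_real[of 2] scaleR_2)
  qed
  then have "norm (f a) \<le> norm (f h) + norm (f g)"
    using norm_triangle_ineq[of "f h" "\<i> *\<^sub>C f g"] f by (simp add: linear_CD norm_scaleC)
  then have "ennreal (norm (f a)) \<le> ennreal (norm (f h)) + ennreal (norm (f g))"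
    by (simp add: ennreal_leI flip: ennreal_plus)
  ultimately show ?thesis by (metis add_mono mult_2 order_trans)
qed

section \<open>Bridges with conditional expectations\<close>

text \<open>Polarization: \<open>E\<close> is self-adjoint on squares, and expanding the square of
  \<open>1 + x\<close> carries this over to \<open>x + adj x\<close>. The same at
  \<open>\<i> *\<^sub>C x\<close> supplies the other half.\<close>

lemma positive_linear_adj:
  fixes E :: "'d::unital_cstar_algebra \<Rightarrow> 'a::unital_cstar_algebra"
  assumes E: "linear_C E" and pos: "\<And>d. \<exists>c. E (adj d * d) = adj c * c"
  shows "E (adj x) = adj (E x)"
proof -
  have sa: "adj (E (adj d * d)) = E (adj d * d)" for d
    using pos[of d] by (auto simp: adj_simps)
  have re: "adj (E x) + adj (E (adj x)) = E x + E (adj x)" for x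
  proof -
    have "E x + E (adj x) = E (adj (1 + x) * (1 + x)) - E (adj 1 * 1) - E (adj x * x)"
      using E by (simp add: linear_CD adj_simps algebra_simps)
    also have "adj \<dots> = \<dots>" by (simp only: adj_diff sa)
    finally show ?thesis by (simp add: adj_add)
  qed
  have "(- \<i>) *\<^sub>C (adj (E (\<i> *\<^sub>C x)) + adj (E (adj (\<i> *\<^sub>C x)))) =
      (- \<i>) *\<^sub>C (E (\<i> *\<^sub>C x) + E (adj (\<i> *\<^sub>C x)))"
    by (simp only: re)
  then have im: "adj (E (adj x)) - adj (E x) = E x - E (adj x)"
    using E by (simp add: linear_CD adj_simps scaleC_add_right scaleC_scaleC scaleC_minus_one)
  have "2 *\<^sub>R adj (E (adj x)) = 2 *\<^sub>R E x"
    using arg_cong2[OF re[of x] im, of "(+)"] by (simp add: scaleR_2 algebra_simps)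
  then have "adj (E (adj x)) = E x" by simp
  then show ?thesis by (metis adj_adj)
qed

text \<open>The bimodule property moves the coefficients \<open>b i\<close> inside \<open>E\<close>,
  where the double sum becomes \<open>adj y * y\<close>. Since
  \<open>E (adj \<omega> * \<omega>) = r *\<^sub>C 1\<close>, faithfulness gives
  \<open>r \<noteq> 0\<close> and positivity of \<open>E\<close> gives \<open>r \<ge> 0\<close>, so
  dividing by \<open>r\<close> preserves positivity.\<close>

lemma compression_cp_map:
  fixes \<iota> :: "'a::unital_cstar_algebra \<Rightarrow> 'd::unital_cstar_algebra" and E :: "'d \<Rightarrow> 'a"
  assumes \<iota>: "unital_star_hom \<iota>" and E: "conditional_expectation \<iota> E" "faithful E"
    and \<omega>: "adj \<omega> = \<omega>" "\<omega> * \<omega> = \<omega>" "\<omega> \<noteq> 0" "E \<omega> = r *\<^sub>C 1"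
  shows "cp_map (\<lambda>d. inverse r *\<^sub>C E (\<omega> * d * \<omega>))"
    and "inverse r *\<^sub>C E (\<omega> * 1 * \<omega>) = 1"
    and "inverse r *\<^sub>C E (\<omega> * \<omega> * \<omega>) = 1"
proof -
  have lin: "linear_C E" and Epos: "\<And>d. \<exists>c. E (adj d * d) = adj c * c"
    and bimod: "\<And>a d a'. E (\<iota> a * d * \<iota> a') = a * E d * a'"
    using E(1) by (auto simp: conditional_expectation_def)
  have r0: "r \<noteq> 0"
  proof
    assume "r = 0"
    then have "E (adj \<omega> * \<omega>) = 0" using \<omega> by simp
    then show False using E(2) \<omega>(3) unfolding faithful_def by blast
  qed
  have "\<exists>c. r *\<^sub>C 1 = adj c * (c::'a)" using Epos[of \<omega>] \<omega> by simp
  then have p: "pos (r *\<^sub>C (1::'a))" using pos_adj_mult by metis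
  define \<rho> where "\<rho> = Re r"
  have "(r - cnj r) *\<^sub>C (1::'a) = 0"
    using pos_selfadj[OF p] scaleC_add_left[of r "- cnj r" "1::'a"]
    by (simp add: adj_simps scaleC_minus_left)
  then have "r = cnj r" using norm_scaleC[of "r - cnj r" "1::'a"] by simp
  then have r: "r = of_real \<rho>" by (metis Reals_cnj_iff \<rho>_def of_real_Re)
  have "\<rho> \<ge> 0"
  proof -
    obtain t where "norm (t *\<^sub>R 1 - r *\<^sub>C (1::'a)) \<le> t" using p unfolding pos_def by blast
    then have "norm ((t - \<rho>) *\<^sub>R (1::'a)) \<le> t" by (simp add: r scaleC_of_real scaleR_diff_left)
    then show ?thesis by simp
  qed
  then have inv: "inverse \<rho> \<ge> 0" by simp
  have sc: "inverse r *\<^sub>C y = inverse \<rho> *\<^sub>R y" for y :: 'a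
    by (simp add: r flip: scaleC_of_real)
  show "inverse r *\<^sub>C E (\<omega> * 1 * \<omega>) = 1" "inverse r *\<^sub>C E (\<omega> * \<omega> * \<omega>) = 1"
    using \<omega> r0 by (simp_all add: scaleC_scaleC)
  show "cp_map (\<lambda>d. inverse r *\<^sub>C E (\<omega> * d * \<omega>))"
    unfolding cp_map_def
  proof (intro conjI allI)
    show "linear_C (\<lambda>d. inverse r *\<^sub>C E (\<omega> * d * \<omega>))"
      unfolding linear_C_def using lin
      by (auto simp: linear_CD algebra_simps scaleC_add_right mult_scaleC_left mult_scaleC_right
          scaleC_scaleC)
    show "inverse r *\<^sub>C E (\<omega> * adj x * \<omega>) = adj (inverse r *\<^sub>C E (\<omega> * x * \<omega>))" for x
      using positive_linear_adj[OF lin Epos, of "\<omega> * x * \<omega>"]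
      by (simp add: sc adj_simps \<omega>(1) mult.assoc)
    fix I :: "nat set" and x :: "nat \<Rightarrow> 'd" and b :: "nat \<Rightarrow> 'a"
    define y where "y = (\<Sum>j\<in>I. x j * \<omega> * \<iota> (b j))"
    have "adj (b i) * (inverse r *\<^sub>C E (\<omega> * (adj (x i) * x j) * \<omega>)) * b j =
        inverse \<rho> *\<^sub>R E (adj (x i * \<omega> * \<iota> (b i)) * (x j * \<omega> * \<iota> (b j)))" for i j
    proof -
      have "adj (x i * \<omega> * \<iota> (b i)) * (x j * \<omega> * \<iota> (b j)) =
          \<iota> (adj (b i)) * (\<omega> * (adj (x i) * x j) * \<omega>) * \<iota> (b j)"
        using \<iota> by (simp add: unital_star_hom_def adj_mult \<omega>(1) mult.assoc)
      then show ?thesis by (simp add: bimod sc)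
    qed
    then have "(\<Sum>i\<in>I. \<Sum>j\<in>I. adj (b i) * (inverse r *\<^sub>C E (\<omega> * (adj (x i) * x j) * \<omega>)) * b j) =
        inverse \<rho> *\<^sub>R E (adj y * y)"
      by (simp add: y_def adj_sum sum_product linear_C_sum[OF lin] flip: scaleR_sum_right)
    moreover have "pos (E (adj y * y))" using Epos[of y] by (auto simp: pos_adj_mult)
    ultimately show "pos (\<Sum>i\<in>I. \<Sum>j\<in>I.
        adj (b i) * (inverse r *\<^sub>C E (\<omega> * (adj (x i) * x j) * \<omega>)) * b j)"
      using inv by (simp add: pos_scaleR)
  qed
qed

lemma ce_bridge_Phi:
  assumes "is_ce_bridge P"
  shows "cp_map (PhiA P)" "PhiA P 1 = 1" "PhiA P (pivot P) = 1"
    and "cp_map (PhiB P)" "PhiB P 1 = 1" "PhiB P (pivot P) = 1"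
proof -
  have "pivot P \<noteq> 0" using assms by (auto simp: is_ce_bridge_def is_bridge_def)
  then show "cp_map (PhiA P)" "PhiA P 1 = 1" "PhiA P (pivot P) = 1"
    and "cp_map (PhiB P)" "PhiB P 1 = 1" "PhiB P (pivot P) = 1"
    using compression_cp_map[of "embA P" "expA P" "pivot P" "pconst P"]
      compression_cp_map[of "embB P" "expB P" "pivot P" "pconst P"] assms
    by (simp_all add: is_ce_bridge_def is_bridge_def PhiA_def[abs_def] PhiB_def[abs_def])
qed

section \<open>Hausdorff estimates for the amplified bridge\<close>

lemma Haus_leI:
  assumes "\<And>x. x \<in> X \<Longrightarrow> \<exists>y\<in>Y. d x y \<le> c" "\<And>y. y \<in> Y \<Longrightarrow> \<exists>x\<in>X. d x y \<le> c"
  shows "Haus d X Y \<le> c"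
  unfolding Haus_def
proof (intro max.boundedI SUP_least)
  show "(INF y\<in>Y. d x y) \<le> c" if "x \<in> X" for x
    using assms(1)[OF that] by (meson INF_lower2)
  show "(INF x\<in>X. d x y) \<le> c" if "y \<in> Y" for y
    using assms(2)[OF that] by (meson INF_lower2)
qed

lemma norm_linear_image_index_le:
  fixes f :: "'a::unital_cstar_algebra \<Rightarrow> 'd::unital_cstar_algebra"
  assumes L: "matrix_slip_norm L" and f: "linear_C f"
    and c: "\<And>a. a \<in> slip_ball type_alg (level_one L) \<Longrightarrow> ennreal (norm (f a)) \<le> ennreal c"
    and X: "X \<in> carrier_mat q q" "L q X \<le> 1" and c0: "c \<ge> 0" and ij: "i < q" "j < q"
  shows "norm (f (X $$ (i, j))) \<le> 2 * c"
proof -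
  have "level_one L (X $$ (i, j)) \<le> 1"
    using level_one_index_le[OF L X(1) ij] X(2) by (rule order_trans)
  then have "ennreal (norm (f (X $$ (i, j)))) \<le> 2 * ennreal c"
    by (intro linear_bound_of_slip_ball[OF L f] c)
  also have "\<dots> = ennreal (2 * c)" using c0 by (simp add: ennreal_mult)
  finally show ?thesis using c0 by (simp add: ennreal_le_iff)
qed

lemma mat_norm_linear_image_le:
  fixes f :: "'a::unital_cstar_algebra \<Rightarrow> 'd::unital_cstar_algebra"
  assumes L: "matrix_slip_norm L" and q: "q \<ge> 1" and f: "linear_C f"
    and c: "\<And>a. a \<in> slip_ball type_alg (level_one L) \<Longrightarrow> ennreal (norm (f a)) \<le> c"
    and X: "X \<in> carrier_mat q q" "L q X \<le> 1"
    and D: "D \<in> carrier_mat q q" "\<And>i j. i < q \<Longrightarrow> j < q \<Longrightarrow> D $$ (i, j) = f (X $$ (i, j))"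
  shows "ennreal (mat_norm D) \<le> 2 * of_nat q * c"
proof (cases c)
  case (real C)
  have "norm (D $$ (i, j)) \<le> 2 * C" if "i < q" "j < q" for i j
    unfolding D(2)[OF that]
    by (rule norm_linear_image_index_le[OF L f _ X]) (use c real that in auto)
  then have "mat_norm D \<le> q * (2 * C)" using real by (intro mat_norm_le_entries D) auto
  then have "ennreal (mat_norm D) \<le> ennreal (2 * real q * C)"
    by (intro ennreal_leI) (simp add: mult_ac)
  also have "\<dots> = 2 * of_nat q * c"
    using real by (simp add: ennreal_mult ennreal_of_nat_eq_real_of_nat)
  finally show ?thesis .
next
  \<comment> \<open>Here \<open>q \<ge> 1\<close> matters: in \<open>ennreal\<close> the product of
    0 and \<open>top\<close> is 0.\<close>
  case top
  then show ?thesis using q by (simp add: ennreal_mult_top)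
qed

lemma state_linear_image_le:
  fixes f :: "'a::unital_cstar_algebra \<Rightarrow> 'd::unital_cstar_algebra"
  assumes L: "matrix_slip_norm L" and q: "q \<ge> 1" and f: "linear_C f"
    and c: "\<And>a. a \<in> slip_ball type_alg (level_one L) \<Longrightarrow> ennreal (norm (f a)) \<le> c"
    and X: "X \<in> carrier_mat q q" "L q X \<le> 1" and \<mu>: "\<mu> \<in> states (mat_alg q)"
  shows "ennreal (cmod (\<mu> (map_mat f X))) \<le> 2 * of_nat q * c"
proof (cases c)
  case (real C)
  have "norm (f (X $$ (i, j))) \<le> 2 * C" if "i < q" "j < q" for i j
    by (rule norm_linear_image_index_le[OF L f _ X]) (use c real that in auto)
  then have "cmod (\<mu> (map_mat f X)) \<le> q * (2 * C)" using X by (intro state_bound \<mu> q) auto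
  then have "ennreal (cmod (\<mu> (map_mat f X))) \<le> ennreal (2 * real q * C)"
    by (intro ennreal_leI) (simp add: mult_ac)
  also have "\<dots> = 2 * of_nat q * c"
    using real by (simp add: ennreal_mult ennreal_of_nat_eq_real_of_nat)
  finally show ?thesis .
next
  case top
  then show ?thesis using q by (simp add: ennreal_mult_top)
qed

text \<open>A state \<open>\<mu>\<close> is approximated by the restriction of \<open>\<mu> \<circ> f\<close>, where \<open>f\<close> is \<open>\<Phi>\<^sup>A\<close> for the bound
  with \<open>\<delta>\<close> and \<open>\<Phi>\<^sup>A \<circ> \<Phi>\<^sup>B\<close> for the one with \<open>\<delta>\<close> hat.\<close>

lemma Haus_restricted_states_le:
  fixes f :: "'d::unital_cstar_algebra \<Rightarrow> 'a::unital_cstar_algebra"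
  assumes L: "matrix_slip_norm L" and q: "q \<ge> 1"
    and f: "linear_C f" "pulls_back_states q f" "f \<omega> = 1" and \<iota>: "unital_star_hom \<iota>"
    and c: "\<And>a. a \<in> slip_ball type_alg (level_one L) \<Longrightarrow> ennreal (norm (f (\<iota> a) - a)) \<le> c"
  shows "Haus (state_dist (mat_alg q) (L q))
      ((\<lambda>\<phi>. restrict (\<phi> \<circ> map_mat \<iota>) (carrier_mat q q)) `
        {\<phi> \<in> states (mat_alg q). \<phi> (mat q q (\<lambda>(i, j). if i = j then \<omega> else 0)) = 1})
      (states (mat_alg q)) \<le> 2 * of_nat q * c"
    (is "Haus _ (?r ` ?S) _ \<le> _")
proof (rule Haus_leI)
  \<comment> \<open>Restrictions of states are states, so this half of the Hausdorff distance
    vanishes.\<close>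
  fix \<psi> assume "\<psi> \<in> ?r ` ?S"
  then obtain \<phi> where "\<phi> \<in> states (mat_alg q)" "\<psi> = ?r \<phi>" by blast
  moreover have "pulls_back_states q \<iota>"
    using \<iota> q by (intro cp_map_pulls_back_states unital_star_hom_cp_map) (auto simp: unital_star_hom_def)
  ultimately have "\<psi> \<in> states (mat_alg q)" by (simp add: pulls_back_states_def comp_def)
  moreover have "state_dist (mat_alg q) (L q) \<psi> \<psi> \<le> 2 * of_nat q * c"
    by (auto simp: state_dist_def intro!: SUP_least)
  ultimately show "\<exists>\<mu>\<in>states (mat_alg q). state_dist (mat_alg q) (L q) \<psi> \<mu> \<le> 2 * of_nat q * c" by blast
next
  fix \<mu> :: "'a mat \<Rightarrow> complex" assume \<mu>: "\<mu> \<in> states (mat_alg q)"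
  define \<phi> where "\<phi> = restrict (\<lambda>X. \<mu> (map_mat f X)) (carrier_mat q q)"
  have "\<phi> \<in> states (mat_alg q)" using f(2) \<mu> by (simp add: \<phi>_def pulls_back_states_def)
  moreover have "\<phi> (mat q q (\<lambda>(i, j). if i = j then \<omega> else 0)) = 1"
  proof -
    have "map_mat f (mat q q (\<lambda>(i, j). if i = j then \<omega> else 0)) = 1\<^sub>m q"
      using f(3) linear_C_zero[OF f(1)] by (intro eq_matI) auto
    then show ?thesis using \<mu> by (simp add: \<phi>_def states_def)
  qed
  moreover have "state_dist (mat_alg q) (L q) (?r \<phi>) \<mu> \<le> 2 * of_nat q * c"
    unfolding state_dist_def
  proof (rule SUP_least)
    fix X :: "'a mat" assume "X \<in> {a \<in> elems (mat_alg q). L q a \<le> 1}"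
    then have X: "X \<in> carrier_mat q q" "L q X \<le> 1" by auto
    \<comment> \<open>The two states differ at \<open>X\<close> by \<open>\<mu>\<close> of the
      entrywise image of \<open>X\<close> under this map, whose size on the slip-norm ball is
      controlled by \<open>c\<close>.\<close>
    have lin: "linear_C (\<lambda>a. f (\<iota> a) - a)"
      using f(1) \<iota> by (auto simp: linear_C_def unital_star_hom_def scaleC_diff_right)
    have "map_mat f (map_mat \<iota> X) = map_mat (\<lambda>a. f (\<iota> a) - a) X + X"
      by (rule eq_matI) auto
    moreover have "\<mu> (map_mat (\<lambda>a. f (\<iota> a) - a) X + X) = \<mu> (map_mat (\<lambda>a. f (\<iota> a) - a) X) + \<mu> X"
      using \<mu> X(1) by (simp add: states_def)
    ultimately have "?r \<phi> X - \<mu> X = \<mu> (map_mat (\<lambda>a. f (\<iota> a) - a) X)" using X(1) by (simp add: \<phi>_def)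
    then show "ennreal (cmod (?r \<phi> X - \<mu> X)) \<le> 2 * of_nat q * c"
      using state_linear_image_le[OF L q lin _ X \<mu>, of c] c by simp
  qed
  ultimately show "\<exists>\<psi>\<in>?r ` ?S. state_dist (mat_alg q) (L q) \<psi> \<mu> \<le> 2 * of_nat q * c" by blast
qed

text \<open>The pivot is diagonal, so multiplying by it acts entrywise. Hence the difference of
  matched elements has as entries the values, at the entries of the given matrix, of the linear map
  in \<open>gammaA\<close> or \<open>gammaB\<close>.\<close>

lemma amplify_reach_le:
  assumes LA: "matrix_slip_norm LA" and LB: "matrix_slip_norm LB"
    and P: "is_ce_bridge P" and adm: "admissible LA LB P" and q: "q \<ge> 1"
  shows "bridge_reach (LA q) (LB q) (amplify q P) \<le> 2 * of_nat q * max (gammaA LA P) (gammaB LB P)"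
proof -
  let ?\<omega> = "mat q q (\<lambda>(i, j). if i = j then pivot P else 0)"
  let ?c = "2 * of_nat q * max (gammaA LA P) (gammaB LB P)"
  have emb: "linear_C (embA P)" "linear_C (embB P)"
    "\<And>a. embA P (adj a) = adj (embA P a)" "\<And>b. embB P (adj b) = adj (embB P b)"
    using P by (auto simp: is_ce_bridge_def is_bridge_def unital_star_hom_def)
  have Phi: "linear_C (PhiA P)" "linear_C (PhiB P)"
    "\<And>x. PhiA P (adj x) = adj (PhiA P x)" "\<And>x. PhiB P (adj x) = adj (PhiB P x)"
    using ce_bridge_Phi[OF P] by (auto simp: cp_map_def)
  have \<omega>: "?\<omega> \<in> carrier_mat q q" by simp
  have right: "(X * ?\<omega>) $$ (i, j) = X $$ (i, j) * pivot P"
    if "X \<in> carrier_mat q q" "i < q" "j < q" for X i j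
  proof -
    have "(X * ?\<omega>) $$ (i, j) = (\<Sum>k<q. if k = j then X $$ (i, k) * pivot P else 0)"
      unfolding index_times_mat[OF that(1) \<omega> that(2,3)] using that by (intro sum.cong) auto
    then show ?thesis using that by simp
  qed
  have left: "(?\<omega> * X) $$ (i, j) = pivot P * X $$ (i, j)"
    if "X \<in> carrier_mat q q" "i < q" "j < q" for X i j
  proof -
    have "(?\<omega> * X) $$ (i, j) = (\<Sum>k<q. if k = i then pivot P * X $$ (k, j) else 0)"
      unfolding index_times_mat[OF \<omega> that(1-3)] using that by (intro sum.cong) auto
    then show ?thesis using that by simp
  qed
  have A: "\<exists>Y\<in>slip_ball (mat_alg q) (LB q).
      norm_dist (mat_alg q) (map_mat (embA P) X * ?\<omega>) (?\<omega> * map_mat (embB P) Y) \<le> ?c"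
    if "X \<in> slip_ball (mat_alg q) (LA q)" for X
  proof -
    have X: "X \<in> carrier_mat q q" "adj X = X" "LA q X \<le> 1" using that by (auto simp: slip_ball_def)
    define Y where "Y = map_mat (\<lambda>a. PhiB P (embA P a)) X"
    have Y: "Y \<in> carrier_mat q q" using X by (simp add: Y_def)
    have "LB q Y \<le> LA q X" using adm q X(1) unfolding admissible_def Y_def by blast
    moreover have "adj Y = map_mat (\<lambda>a. PhiB P (embA P a)) (adj X)"
      by (rule eq_matI) (auto simp: Y_def emb Phi)
    ultimately have ball: "Y \<in> slip_ball (mat_alg q) (LB q)"
      using X Y by (simp add: slip_ball_def Y_def[symmetric])
    have "ennreal (mat_norm (map_mat (embA P) X * ?\<omega> - ?\<omega> * map_mat (embB P) Y))
        \<le> 2 * of_nat q * gammaA LA P"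
    proof (rule mat_norm_linear_image_le[OF LA q _ _ X(1,3)])
      show "linear_C (\<lambda>a. embA P a * pivot P - pivot P * embB P (PhiB P (embA P a)))"
        using emb(1,2) Phi(2) unfolding linear_C_def
        by (auto simp: algebra_simps mult_scaleC_left mult_scaleC_right scaleC_diff_right)
      show "ennreal (norm (embA P a * pivot P - pivot P * embB P (PhiB P (embA P a)))) \<le> gammaA LA P"
        if "a \<in> slip_ball type_alg (level_one LA)" for a
        unfolding gammaA_def using that by (rule SUP_upper)
    qed (use X Y in \<open>auto simp: right left Y_def simp del: index_mult_mat(1)\<close>)
    also have "\<dots> \<le> ?c" by (intro mult_left_mono) auto
    finally show ?thesis by (intro bexI[OF _ ball]) (simp add: norm_dist_def)
  qed
  have B: "\<exists>X\<in>slip_ball (mat_alg q) (LA q).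
      norm_dist (mat_alg q) (map_mat (embA P) X * ?\<omega>) (?\<omega> * map_mat (embB P) Y) \<le> ?c"
    if "Y \<in> slip_ball (mat_alg q) (LB q)" for Y
  proof -
    have Y: "Y \<in> carrier_mat q q" "adj Y = Y" "LB q Y \<le> 1" using that by (auto simp: slip_ball_def)
    define X where "X = map_mat (\<lambda>b. PhiA P (embB P b)) Y"
    have X: "X \<in> carrier_mat q q" using Y by (simp add: X_def)
    have "LA q X \<le> LB q Y" using adm q Y(1) unfolding admissible_def X_def by blast
    moreover have "adj X = map_mat (\<lambda>b. PhiA P (embB P b)) (adj Y)"
      by (rule eq_matI) (auto simp: X_def emb Phi)
    ultimately have ball: "X \<in> slip_ball (mat_alg q) (LA q)"
      using X Y by (simp add: slip_ball_def X_def[symmetric])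
    have "ennreal (mat_norm (map_mat (embA P) X * ?\<omega> - ?\<omega> * map_mat (embB P) Y))
        \<le> 2 * of_nat q * gammaB LB P"
    proof (rule mat_norm_linear_image_le[OF LB q _ _ Y(1,3)])
      show "linear_C (\<lambda>b. embA P (PhiA P (embB P b)) * pivot P - pivot P * embB P b)"
        using emb(1,2) Phi(1) unfolding linear_C_def
        by (auto simp: algebra_simps mult_scaleC_left mult_scaleC_right scaleC_diff_right)
      show "ennreal (norm (embA P (PhiA P (embB P b)) * pivot P - pivot P * embB P b)) \<le> gammaB LB P"
        if "b \<in> slip_ball type_alg (level_one LB)" for b
        unfolding gammaB_def using that by (rule SUP_upper)
    qed (use X Y in \<open>auto simp: right left X_def simp del: index_mult_mat(1)\<close>)
    also have "\<dots> \<le> ?c" by (intro mult_left_mono) auto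
    finally show ?thesis by (intro bexI[OF _ ball]) (simp add: norm_dist_def)
  qed
  show ?thesis
    unfolding bridge_reach_def
    by (rule Haus_leI) (use A B in \<open>auto simp: amplify_def\<close>)
qed

text \<open>Two choices of \<open>f\<close> bound the same Hausdorff distance, hence the minimum.
  The composite also sends the pivot to 1, as its inner map already does and the outer maps are
  unital.\<close>

lemma amplify_height_le:
  assumes LA: "matrix_slip_norm LA" and LB: "matrix_slip_norm LB"
    and P: "is_ce_bridge P" and q: "q \<ge> 1"
  shows "bridge_height (LA q) (LB q) (amplify q P) \<le> 2 * of_nat q *
    max (min (deltaA LA P) (delta_hatA LA P)) (min (deltaB LB P) (delta_hatB LB P))"
proof -
  have emb: "unital_star_hom (embA P)" "unital_star_hom (embB P)"
    using P by (auto simp: is_ce_bridge_def is_bridge_def)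
  note Phi = ce_bridge_Phi[OF P]
  have lin: "linear_C (PhiA P)" "linear_C (PhiB P)" "linear_C (embA P)" "linear_C (embB P)"
    using Phi emb by (auto simp: cp_map_def unital_star_hom_def)
  have pb: "pulls_back_states q (PhiA P)" "pulls_back_states q (PhiB P)"
    "pulls_back_states q (embA P)" "pulls_back_states q (embB P)"
    using Phi emb q by (auto intro!: cp_map_pulls_back_states unital_star_hom_cp_map
        simp: unital_star_hom_def)
  have one: "embA P 1 = 1" "embB P 1 = 1" using emb by (auto simp: unital_star_hom_def)
  let ?S = "\<lambda>\<iota>. (\<lambda>\<phi>. restrict (\<phi> \<circ> map_mat \<iota>) (carrier_mat q q)) `
    {\<phi> \<in> states (mat_alg q). \<phi> (mat q q (\<lambda>(i, j). if i = j then pivot P else 0)) = 1}"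
  have "Haus (state_dist (mat_alg q) (LA q)) (?S (embA P)) (states (mat_alg q)) \<le>
      2 * of_nat q * deltaA LA P"
    by (rule Haus_restricted_states_le[OF LA q lin(1) pb(1) Phi(3) emb(1)])
      (unfold deltaA_def, rule SUP_upper)
  moreover have "Haus (state_dist (mat_alg q) (LA q)) (?S (embA P)) (states (mat_alg q)) \<le>
      2 * of_nat q * delta_hatA LA P"
  proof (rule Haus_restricted_states_le[OF LA q _ _ _ emb(1)])
    show "linear_C (\<lambda>d. PhiA P (embB P (PhiB P d)))" using lin by (simp add: linear_C_def)
    show "pulls_back_states q (\<lambda>d. PhiA P (embB P (PhiB P d)))"
      by (rule pulls_back_states_comp[OF pb(1) pulls_back_states_comp[OF pb(4,2)]])
    show "PhiA P (embB P (PhiB P (pivot P))) = 1" using Phi one by simp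
    show "ennreal (norm (PhiA P (embB P (PhiB P (embA P a))) - a)) \<le> delta_hatA LA P"
      if "a \<in> slip_ball type_alg (level_one LA)" for a
      unfolding delta_hatA_def using that by (subst norm_minus_commute) (rule SUP_upper)
  qed
  ultimately have A: "Haus (state_dist (mat_alg q) (LA q)) (?S (embA P)) (states (mat_alg q)) \<le>
      2 * of_nat q * min (deltaA LA P) (delta_hatA LA P)" by (simp add: min_def)
  have "Haus (state_dist (mat_alg q) (LB q)) (?S (embB P)) (states (mat_alg q)) \<le>
      2 * of_nat q * deltaB LB P"
    by (rule Haus_restricted_states_le[OF LB q lin(2) pb(2) Phi(6) emb(2)])
      (unfold deltaB_def, rule SUP_upper)
  moreover have "Haus (state_dist (mat_alg q) (LB q)) (?S (embB P)) (states (mat_alg q)) \<le>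
      2 * of_nat q * delta_hatB LB P"
  proof (rule Haus_restricted_states_le[OF LB q _ _ _ emb(2)])
    show "linear_C (\<lambda>d. PhiB P (embA P (PhiA P d)))" using lin by (simp add: linear_C_def)
    show "pulls_back_states q (\<lambda>d. PhiB P (embA P (PhiA P d)))"
      by (rule pulls_back_states_comp[OF pb(2) pulls_back_states_comp[OF pb(3,1)]])
    show "PhiB P (embA P (PhiA P (pivot P))) = 1" using Phi one by simp
    show "ennreal (norm (PhiB P (embA P (PhiA P (embB P b))) - b)) \<le> delta_hatB LB P"
      if "b \<in> slip_ball type_alg (level_one LB)" for b
      unfolding delta_hatB_def using that by (subst norm_minus_commute) (rule SUP_upper)
  qed
  ultimately have B: "Haus (state_dist (mat_alg q) (LB q)) (?S (embB P)) (states (mat_alg q)) \<le>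
      2 * of_nat q * min (deltaB LB P) (delta_hatB LB P)" by (simp add: min_def)
  have "bridge_height (LA q) (LB q) (amplify q P) \<le>
      max (2 * of_nat q * min (deltaA LA P) (delta_hatA LA P))
        (2 * of_nat q * min (deltaB LB P) (delta_hatB LB P))"
    using max.mono[OF A B]
    by (simp only: bridge_height_def pivot_states_A_def pivot_states_B_def pivot_states_def
        amplify_def bridge.simps ce_bridge.simps elems_mat_alg)
  also have "\<dots> \<le> 2 * of_nat q *
      max (min (deltaA LA P) (delta_hatA LA P)) (min (deltaB LB P) (delta_hatB LB P))"
    by (intro max.boundedI mult_left_mono) auto
  finally show ?thesis .
qed

theorem theorem5p4:
  fixes LA :: "nat \<Rightarrow> 'a::unital_cstar_algebra mat \<Rightarrow> ennreal"
    and LB :: "nat \<Rightarrow> 'b::unital_cstar_algebra mat \<Rightarrow> ennreal"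
    and P :: "('a, 'b, 'd::unital_cstar_algebra) ce_bridge"
    and q :: nat
  assumes "matrix_slip_norm LA" and "matrix_slip_norm LB"
    and "is_ce_bridge P" and "admissible LA LB P"
    and "q \<ge> 1"
  shows "bridge_reach (LA q) (LB q) (amplify q P)
           \<le> 2 * of_nat q * max (gammaA LA P) (gammaB LB P)
       \<and> bridge_height (LA q) (LB q) (amplify q P)
           \<le> 2 * of_nat q * max (min (deltaA LA P) (delta_hatA LA P))
                               (min (deltaB LB P) (delta_hatB LB P))
       \<and> bridge_length (LA q) (LB q) (amplify q P)
           \<le> 2 * of_nat q * max (max (gammaA LA P) (gammaB LB P))
                               (max (min (deltaA LA P) (delta_hatA LA P))
                                    (min (deltaB LB P) (delta_hatB LB P)))"
proof (intro conjI)
  note reach = amplify_reach_le[OF assms] and height = amplify_height_le[OF assms(1-3,5)]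
  show "bridge_reach (LA q) (LB q) (amplify q P)
      \<le> 2 * of_nat q * max (gammaA LA P) (gammaB LB P)" by (rule reach)
  show "bridge_height (LA q) (LB q) (amplify q P)
      \<le> 2 * of_nat q * max (min (deltaA LA P) (delta_hatA LA P))
          (min (deltaB LB P) (delta_hatB LB P))" by (rule height)
  show "bridge_length (LA q) (LB q) (amplify q P)
      \<le> 2 * of_nat q * max (max (gammaA LA P) (gammaB LB P))
          (max (min (deltaA LA P) (delta_hatA LA P)) (min (deltaB LB P) (delta_hatB LB P)))"
    unfolding bridge_length_def
    by (rule max.boundedI, rule order_trans[OF reach mult_left_mono[OF max.cobounded1]], simp,
        rule order_trans[OF height mult_left_mono[OF max.cobounded2]], simp)
qed

end
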